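(* Let $n>r\ge 3$ and $1\le t<2^r-r-1$ be integers. Suppose that $\mathcal F\subset 2^{[n]}$ is a non-trivial $r$-wise $t$-agreeing family with $|\mathcal F|=(r+t+1)2^{n-r-t}$. Then there exist a set $A\subset[n]$ with $|A|=r+t$ and a set $R\subset A$ such that $$\mathcal F=\{F\,\Delta\, R: F\subset[n],\ |F\cap A|\le 1\},$$ where $\Delta$ denotes symmetric difference.
   Context: $[n]=\{1,\ldots,n\}$. Sets $F_1,\ldots,F_r\subset[n]$ agree on a coordinate $x\in[n]$ if either $x\in\bigcap_{i\in[r]}F_i$ or $x\notin\bigcup_{i\in[r]}F_i$. A family $\mathcal F\subset 2^{[n]}$ is $r$-wise $t$-agreeing if any $r$ sets from $\mathcal F$ (not necessarily distinct) agree on at least $t$ coordinates. $\mathcal F$ is non-trivial if $\bigcap_{A\in\mathcal F}A=\emptyset$ and $\bigcup_{A\in\mathcal F}A=[n]$. *)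

theory Defs
  imports Main
begin

definition agree_on :: "nat \<Rightarrow> (nat \<Rightarrow> nat set) \<Rightarrow> nat \<Rightarrow> bool" where
  "agree_on r Fs x \<longleftrightarrow> (\<forall>i<r. x \<in> Fs i) \<or> (\<forall>i<r. x \<notin> Fs i)"

definition r_wise_t_agreeing :: "nat \<Rightarrow> nat \<Rightarrow> nat \<Rightarrow> nat set set \<Rightarrow> bool" where
  "r_wise_t_agreeing n r t \<F> \<longleftrightarrow>
     (\<forall>Fs. (\<forall>i<r. Fs i \<in> \<F>) \<longrightarrow> card {x \<in> {1..n}. agree_on r Fs x} \<ge> t)"

definition nontrivial :: "nat \<Rightarrow> nat set set \<Rightarrow> bool" where
  "nontrivial n \<F> \<longleftrightarrow> \<Inter>\<F> = {} \<and> \<Union>\<F> = {1..n}"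

end

theory Submission
  imports Defs Complex_Main
begin

text \<open>Down-compressions and shifts preserve agreement, and neither can create an extremal family
  from a non-extremal one; a compression that destroys non-triviality at \<open>x\<close> exhibits the family as
  small by induction on the ground set. It remains to bound families that are closed under shifting.
  Written as 0/1 words (\<open>True\<close> for an absent element), such a family is \<open>r\<close>-wise
  \<open>t\<close>-intersecting iff among any \<open>r\<close> words some prefix of length \<open>i\<close> contains at least
  \<open>(r - 1) i + t\<close> entries \<open>True\<close>. Fixing a first letter \<open>True\<close> replaces \<open>t\<close> by \<open>t - 1\<close>, fixing
  \<open>False\<close> replaces it by \<open>t + r - 1\<close>. Cut at the first \<open>t\<close> letters: the section of
  \<open>True ... True\<close> is non-trivial \<open>(r - 1)\<close>-wise intersecting, hence of density at most
  \<open>(r + 1) / 2^r\<close>, and each section with one \<open>False\<close> has density at most \<open>1 / 2^r\<close>; the sum of these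
  is the claimed bound. If sections with two letters \<open>False\<close> occur, then the former sections are much
  smaller, and the tail, bounded by powers of \<open>x\<close> with \<open>1 + x^r \<le> 2 x\<close>, does not compensate the loss.\<close>

section \<open>Bit strings and prefix counts\<close>

text \<open>The condition \<open>t < 2 ^ r - r - 1\<close> says that (r + t + 1) / 2^(r + t) is
  below 1 / 2^t, the density of the trivial family of all sets avoiding t fixed points. It also
  keeps the tail small: beside the amount t / 2^r granted to the sections with one
  \<open>False\<close>, the leading tail term is roughly t^2 / 2^(2 r + 1), about half as much at
  worst. The condition on x comes from reading a random word: a letter \<open>True\<close> lowers
  the threshold s by 1, a letter \<open>False\<close> raises it by r - 1, so a bound a(s) must
  dominate (a(s - 1) + a(s + r - 1)) / 2, and for x > 0 the powers x^s do so exactly when 1 + x^r <=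
  2 x. Sections are bounded by the theorem itself, for shorter words or for r - 1, whence a nested
  induction on r and n. It starts at r = 3, where there is little room: pairwise families are
  bounded by 1 / 2 through complements, and t = 2 and t = 3 get their own estimates. Equality is
  tracked through one word: \<open>False\<close>, then r + t - 1 letters \<open>True\<close>, then
  only \<open>False\<close>. The words dominating it form the extremal family.\<close>

definition cnt :: "bool list \<Rightarrow> nat \<Rightarrow> nat" where
  "cnt v i = count_list (take i v) True"

lemma cnt_Nil [simp]: "cnt [] i = 0"
  by (simp add: cnt_def)

lemma cnt_0 [simp]: "cnt v 0 = 0"
  by (simp add: cnt_def)

lemma cnt_Cons [simp]: "cnt (b # v) (Suc i) = of_bool b + cnt v i"
  by (cases b) (simp_all add: cnt_def)

lemma cnt_append: "cnt (p @ v) i = cnt p i + cnt v (i - length p)"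
  by (simp add: cnt_def)

lemma cnt_replicate [simp]:
  "cnt (replicate n True) i = min i n" "cnt (replicate n False) i = 0"
proof (induction n arbitrary: i)
  case (Suc n)
  { case 1 then show ?case using Suc by (cases i) auto }
  { case 2 then show ?case using Suc by (cases i) auto }
qed simp_all

lemma cnt_le: "cnt v i \<le> i"
  by (metis cnt_def count_le_length length_take min.bounded_iff order_trans nle_le)

lemma cnt_le_length: "cnt v i \<le> length v"
  by (metis cnt_def count_le_length length_take min.bounded_iff order_trans nle_le)

lemma cnt_length: "length v \<le> i \<Longrightarrow> cnt v i = cnt v (length v)"
  by (simp add: cnt_def)

lemma cnt_mono: "i \<le> j \<Longrightarrow> cnt v i \<le> cnt v j"
proof (induction v arbitrary: i j)
  case (Cons b v)
  then show ?case by (cases i; cases j) auto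
qed simp

text \<open>The order generated by raising letters to \<open>True\<close> and moving letters
  \<open>True\<close> to the left. Quantifying over all i is harmless, since \<open>cnt\<close> is
  constant beyond the length.\<close>

definition dominated :: "bool list \<Rightarrow> bool list \<Rightarrow> bool" where
  "dominated v w \<longleftrightarrow> length v = length w \<and> (\<forall>i. cnt v i \<le> cnt w i)"

lemma dominated_Cons: "dominated v w \<Longrightarrow> dominated (b # v) (b # w)"
  unfolding dominated_def
proof (intro conjI allI; elim conjE)
  fix i assume "\<forall>i. cnt v i \<le> cnt w i"
  then show "cnt (b # v) i \<le> cnt (b # w) i" by (cases i) auto
qed simp

lemma dominated_append:
  "dominated p q \<Longrightarrow> dominated v w \<Longrightarrow> dominated (p @ v) (q @ w)"
  by (auto simp: dominated_def cnt_append add_mono)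

lemma dominated_refl [simp]: "dominated v v"
  by (simp add: dominated_def)

lemma dominated_replicate: "length v = n \<Longrightarrow> dominated v (replicate n True)"
  using cnt_le cnt_le_length by (auto simp: dominated_def)

definition shifted :: "nat \<Rightarrow> bool list set \<Rightarrow> bool" where
  "shifted n F \<longleftrightarrow> (\<forall>v\<in>F. length v = n) \<and> (\<forall>v\<in>F. \<forall>w. dominated v w \<longrightarrow> w \<in> F)"

lemma shiftedD: "shifted n F \<Longrightarrow> v \<in> F \<Longrightarrow> dominated v w \<Longrightarrow> w \<in> F"
  by (auto simp: shifted_def)

lemma shifted_length: "shifted n F \<Longrightarrow> v \<in> F \<Longrightarrow> length v = n"
  by (auto simp: shifted_def)

section \<open>Prefix conditions and the effect of fixing letters\<close>

definition sec :: "bool list \<Rightarrow> bool list set \<Rightarrow> bool list set" where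
  "sec p F = {v. p @ v \<in> F}"

lemma sec_iff [simp]: "v \<in> sec p F \<longleftrightarrow> p @ v \<in> F"
  by (simp add: sec_def)

lemma sec_sec: "sec q (sec p F) = sec (p @ q) F"
  by auto

lemma sec_Nil [simp]: "sec [] F = F"
  by auto

lemma shifted_sec:
  assumes "shifted (length p + n) F" shows "shifted n (sec p F)"
  using assms dominated_append[of p p]
  by (auto simp: shifted_def) (metis add_left_cancel length_append)

text \<open>Equivalently, for words of length at least i, the first i letters of the r words contain
  at most i - t letters \<open>False\<close> altogether, which leaves t positions where all words
  have \<open>True\<close>. Being linear in i, the condition passes to sections with only t
  changed.\<close>

definition hits :: "nat \<Rightarrow> nat \<Rightarrow> bool list set \<Rightarrow> bool" where
  "hits r t F \<longleftrightarrow> (\<forall>vs. (\<forall>j<r. vs j \<in> F) \<longrightarrow> (\<exists>i. (r - 1) * i + t \<le> (\<Sum>j<r. cnt (vs j) i)))"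

definition reach :: "nat \<Rightarrow> nat \<Rightarrow> bool list set \<Rightarrow> bool" where
  "reach r s F \<longleftrightarrow> (\<forall>v\<in>F. \<exists>i. (r - 1) * i + s \<le> r * cnt v i)"

lemma hits_reach: "hits r s F \<Longrightarrow> reach r s F"
  unfolding hits_def reach_def
proof (intro ballI)
  fix v assume h: "\<forall>vs. (\<forall>j<r. vs j \<in> F) \<longrightarrow> (\<exists>i. (r - 1) * i + s \<le> (\<Sum>j<r. cnt (vs j) i))"
    and "v \<in> F"
  then show "\<exists>i. (r - 1) * i + s \<le> r * cnt v i"
    using h[rule_format, of "\<lambda>_. v"] by simp
qed

lemma hits_weaken: "hits r s F \<Longrightarrow> s' \<le> s \<Longrightarrow> hits r s' F"
  unfolding hits_def by (meson add_left_mono order_trans)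

text \<open>Removing the first letter takes r from the right-hand side and r - 1 from the left, so
  the threshold drops by 1. Once the new threshold is 0, the empty prefix serves.\<close>

lemma sec_True_reach: "reach r s F \<Longrightarrow> reach r (s - 1) (sec [True] F)"
  unfolding reach_def
proof (intro ballI)
  fix v assume h: "\<forall>v\<in>F. \<exists>i. (r - 1) * i + s \<le> r * cnt v i" and "v \<in> sec [True] F"
  then obtain i where i: "(r - 1) * i + s \<le> r * cnt (True # v) i" by auto
  show "\<exists>i. (r - 1) * i + (s - 1) \<le> r * cnt v i"
  proof (cases "s \<le> 1 \<or> i = 0")
    case True
    with i show ?thesis by (intro exI[of _ 0]) auto
  next
    case False
    then obtain k where "i = Suc k" by (cases i) auto
    with i False show ?thesis by (intro exI[of _ k]) (cases r; auto simp: algebra_simps)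
  qed
qed

text \<open>Only the left-hand side loses r - 1 here. \<open>1 <= s\<close> excludes the empty
  prefix, which has no first letter to remove.\<close>

lemma sec_False_reach:
  assumes "reach r s F" "1 \<le> s" "1 \<le> r"
  shows "reach r (s + r - 1) (sec [False] F)"
  unfolding reach_def
proof (intro ballI)
  fix v assume "v \<in> sec [False] F"
  with assms(1) obtain i where i: "(r - 1) * i + s \<le> r * cnt (False # v) i"
    unfolding reach_def by auto
  show "\<exists>i. (r - 1) * i + (s + r - 1) \<le> r * cnt v i"
  proof (cases i)
    case 0
    with i assms show ?thesis by auto
  next
    case (Suc k)
    with i assms show ?thesis by (intro exI[of _ k]) (cases r; auto simp: algebra_simps)
  qed
qed

lemma sec_True_hits: "hits r s F \<Longrightarrow> hits r (s - 1) (sec [True] F)"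
  unfolding hits_def
proof (intro allI impI)
  fix vs assume h: "\<forall>vs. (\<forall>j<r. vs j \<in> F) \<longrightarrow> (\<exists>i. (r - 1) * i + s \<le> (\<Sum>j<r. cnt (vs j) i))"
    and v: "\<forall>j<r. vs j \<in> sec [True] F"
  from v h[rule_format, of "\<lambda>j. True # vs j"]
  obtain i where i: "(r - 1) * i + s \<le> (\<Sum>j<r. cnt (True # vs j) i)" by auto
  show "\<exists>i. (r - 1) * i + (s - 1) \<le> (\<Sum>j<r. cnt (vs j) i)"
  proof (cases "s \<le> 1 \<or> i = 0")
    case True
    with i show ?thesis by (intro exI[of _ 0]) auto
  next
    case False
    then obtain k where "i = Suc k" by (cases i) auto
    with i False show ?thesis
      by (intro exI[of _ k]) (cases r; auto simp: algebra_simps sum.distrib sum_Suc)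
  qed
qed

lemma sec_False_hits:
  assumes "hits r s F" "1 \<le> s" "1 \<le> r"
  shows "hits r (s + r - 1) (sec [False] F)"
  unfolding hits_def
proof (intro allI impI)
  fix vs assume v: "\<forall>j<r. vs j \<in> sec [False] F"
  then obtain i where i: "(r - 1) * i + s \<le> (\<Sum>j<r. cnt (False # vs j) i)"
    using assms(1)[unfolded hits_def, rule_format, of "\<lambda>j. False # vs j"] by auto
  show "\<exists>i. (r - 1) * i + (s + r - 1) \<le> (\<Sum>j<r. cnt (vs j) i)"
  proof (cases i)
    case 0
    with i assms show ?thesis by auto
  next
    case (Suc k)
    with i assms show ?thesis
      by (intro exI[of _ k]) (cases r; auto simp: algebra_simps)
  qed
qed

text \<open>\<open>length p <= s\<close> keeps the threshold positive in front of every letter. For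
  \<open>length p = s\<close> the new threshold is r times the number of letters
  \<open>False\<close>; this is why the cut is made after t letters.\<close>

lemma hits_sec:
  assumes "hits r s F" "length p \<le> s" "1 \<le> r"
  shows "hits r (s - length p + r * count_list p False) (sec p F)"
  using assms
proof (induction p arbitrary: s F)
  case (Cons b p)
  show ?case
  proof (cases b)
    case True
    have "hits r (s - 1) (sec [True] F)" by (rule sec_True_hits) fact
    from Cons.IH[OF this] Cons.prems show ?thesis
      using True by (simp add: sec_sec)
  next
    case False
    have "hits r (s + r - 1) (sec [False] F)" by (rule sec_False_hits) (use Cons.prems in auto)
    from Cons.IH[OF this] Cons.prems False show ?thesis
      by (simp add: sec_sec algebra_simps Suc_diff_le)
  qed
qed simp

section \<open>Densities of sections\<close>

definition dens :: "nat \<Rightarrow> bool list set \<Rightarrow> real" where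
  "dens n F = card F / 2 ^ n"

lemma finite_lists: "finite {v :: bool list. length v = n}"
  using finite_lists_length_eq[of "UNIV :: bool set" n] by simp

lemma card_lists: "card {v :: bool list. length v = n} = 2 ^ n"
  using card_lists_length_eq[of "UNIV :: bool set" n] by simp

lemma finite_fam: "\<forall>v\<in>F. length v = n \<Longrightarrow> finite (F :: bool list set)"
  by (rule finite_subset[OF _ finite_lists]) auto

lemma dens_empty [simp]: "dens n {} = 0"
  by (simp add: dens_def)

lemma dens_mono:
  "F \<subseteq> G \<Longrightarrow> \<forall>v\<in>G. length v = n \<Longrightarrow> dens n F \<le> dens n G"
  by (auto simp: dens_def intro!: divide_right_mono card_mono finite_fam)

lemma dens_le_1: "\<forall>v\<in>F. length v = n \<Longrightarrow> dens n F \<le> 1"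
proof -
  assume "\<forall>v\<in>F. length v = n"
  then have "card F \<le> 2 ^ n"
    unfolding card_lists[symmetric] by (intro card_mono finite_lists) auto
  then have "real (card F) \<le> real (2 ^ n)" by (simp only: of_nat_le_iff)
  then show ?thesis by (simp add: dens_def)
qed

lemma dens_eq_1: 
  assumes "\<forall>v\<in>F. length v = n" "dens n F = 1" shows "F = {v. length v = n}"
proof -
  have "real (card F) = real (2 ^ n)" using assms(2) by (simp add: dens_def)
  then have "card F = 2 ^ n" by (simp only: of_nat_eq_iff)
  then show ?thesis
    unfolding card_lists[symmetric] using assms(1)
    by (intro card_subset_eq finite_lists) auto
qed

lemma dens_Suc:
  assumes "\<forall>v\<in>F. length v = Suc n"
  shows "dens (Suc n) F = (dens n (sec [True] F) + dens n (sec [False] F)) / 2"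
proof -
  have "F = (#) True ` sec [True] F \<union> (#) False ` sec [False] F"
  proof (intro set_eqI iffI)
    fix v assume "v \<in> F"
    moreover from this assms obtain b w where "v = b # w" by (metis length_Suc_conv)
    ultimately show "v \<in> (#) True ` sec [True] F \<union> (#) False ` sec [False] F"
      by (cases b) auto
  qed auto
  moreover have "finite (sec [b] F)" for b
    using assms by (intro finite_fam[of _ n]) fastforce
  moreover have "(#) True ` sec [True] F \<inter> (#) False ` sec [False] F = {}"
    by blast
  ultimately have "card F = card ((#) True ` sec [True] F) + card ((#) False ` sec [False] F)"
    by (metis card_Un_disjoint finite_imageI)
  then have "card F = card (sec [True] F) + card (sec [False] F)"
    by (simp add: card_image)
  then show ?thesis by (simp add: dens_def field_simps)
qed

text \<open>Splitting off the first letter reproduces Pascal's rule, so sections with equally many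
  letters \<open>False\<close> are collected with binomial weights. The strict form lets equality be
  read off a single section.\<close>

lemma dens_cut:
  fixes \<sigma> :: "nat \<Rightarrow> real"
  assumes "\<forall>v\<in>F. length v = t + n"
    and "\<And>p. length p = t \<Longrightarrow> dens n (sec p F) \<le> \<sigma> (count_list p False)"
  shows "dens (t + n) F \<le> (\<Sum>k\<le>t. (t choose k) * \<sigma> k) / 2 ^ t"
    and "length p = t \<Longrightarrow> dens n (sec p F) < \<sigma> (count_list p False) \<Longrightarrow>
      dens (t + n) F < (\<Sum>k\<le>t. (t choose k) * \<sigma> k) / 2 ^ t"
proof -
  have "dens (t + n) F \<le> (\<Sum>k\<le>t. (t choose k) * \<sigma> k) / 2 ^ t \<and>
    (length p = t \<longrightarrow> dens n (sec p F) < \<sigma> (count_list p False) \<longrightarrow>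
      dens (t + n) F < (\<Sum>k\<le>t. (t choose k) * \<sigma> k) / 2 ^ t)"
    using assms
  proof (induction t arbitrary: F \<sigma> p)
    case 0
    from 0(2)[of "[]"] show ?case by simp
  next
    case (Suc t)
    define A where "A = (\<Sum>k\<le>t. (t choose k) * \<sigma> k)"
    define B where "B = (\<Sum>k\<le>t. (t choose k) * \<sigma> (Suc k))"
    have "(\<Sum>k\<le>Suc t. (Suc t choose k) * \<sigma> k)
        = \<sigma> 0 + (\<Sum>k\<le>t. (t choose Suc k) * \<sigma> (Suc k)) + B"
      by (simp add: sum.atMost_Suc_shift B_def sum.distrib algebra_simps del: sum.atMost_Suc)
    also have "\<sigma> 0 + (\<Sum>k\<le>t. (t choose Suc k) * \<sigma> (Suc k)) = (\<Sum>k\<le>Suc t. (t choose k) * \<sigma> k)"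
      by (simp add: sum.atMost_Suc_shift del: sum.atMost_Suc)
    finally have pascal: "(\<Sum>k\<le>Suc t. (Suc t choose k) * \<sigma> k) = A + B"
      by (simp add: A_def)
    have d: "dens (Suc t + n) F = (dens (t + n) (sec [True] F) + dens (t + n) (sec [False] F)) / 2"
      using dens_Suc[of F "t + n"] Suc.prems(1) by simp
    have T: "dens (t + n) (sec [True] F) \<le> A / 2 ^ t \<and>
      (length q = t \<longrightarrow> dens n (sec q (sec [True] F)) < \<sigma> (count_list q False) \<longrightarrow>
        dens (t + n) (sec [True] F) < A / 2 ^ t)" for q
      unfolding A_def
    proof (rule Suc.IH)
      show "\<forall>v\<in>sec [True] F. length v = t + n" using Suc.prems(1) by fastforce
      show "\<And>p. length p = t \<Longrightarrow> dens n (sec p (sec [True] F)) \<le> \<sigma> (count_list p False)"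
        using Suc.prems(2)[of "True # _"] by (auto simp: sec_sec)
    qed
    have F: "dens (t + n) (sec [False] F) \<le> B / 2 ^ t \<and>
      (length q = t \<longrightarrow> dens n (sec q (sec [False] F)) < \<sigma> (Suc (count_list q False)) \<longrightarrow>
        dens (t + n) (sec [False] F) < B / 2 ^ t)" for q
      unfolding B_def
    proof (rule Suc.IH)
      show "\<forall>v\<in>sec [False] F. length v = t + n" using Suc.prems(1) by fastforce
      show "\<And>p. length p = t \<Longrightarrow> dens n (sec p (sec [False] F)) \<le> \<sigma> (Suc (count_list p False))"
        using Suc.prems(2)[of "False # _"] by (auto simp: sec_sec)
    qed
    have e: "(\<Sum>k\<le>Suc t. (Suc t choose k) * \<sigma> k) / 2 ^ Suc t = (A / 2 ^ t + B / 2 ^ t) / 2"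
      unfolding pascal by (simp add: field_simps)
    show ?case
      unfolding e d
    proof (intro conjI impI)
      show "(dens (t + n) (sec [True] F) + dens (t + n) (sec [False] F)) / 2
          \<le> (A / 2 ^ t + B / 2 ^ t) / 2"
        using T F by (intro divide_right_mono add_mono) auto
      assume p: "length p = Suc t" "dens n (sec p F) < \<sigma> (count_list p False)"
      then obtain b q where q: "p = b # q" "length q = t" by (metis length_Suc_conv)
      have "dens (t + n) (sec [True] F) + dens (t + n) (sec [False] F) < A / 2 ^ t + B / 2 ^ t"
      proof (cases b)
        case True
        with T[of q] F[of q] p q show ?thesis
          by (intro add_less_le_mono) (auto simp: sec_sec)
      next
        case False
        with T[of q] F[of q] p q show ?thesis
          by (intro add_le_less_mono) (auto simp: sec_sec)
      qed
      then show "(dens (t + n) (sec [True] F) + dens (t + n) (sec [False] F)) / 2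
          < (A / 2 ^ t + B / 2 ^ t) / 2"
        by (rule divide_strict_right_mono) simp
    qed
  qed
  then show "dens (t + n) F \<le> (\<Sum>k\<le>t. (t choose k) * \<sigma> k) / 2 ^ t"
    and "length p = t \<Longrightarrow> dens n (sec p F) < \<sigma> (count_list p False) \<Longrightarrow>
      dens (t + n) F < (\<Sum>k\<le>t. (t choose k) * \<sigma> k) / 2 ^ t"
    by auto
qed

lemma reach_0_empty:
  assumes "reach r s F" "\<forall>v\<in>F. length v = 0" "1 \<le> s"
  shows "F = {}"
proof (rule ccontr)
  assume "F \<noteq> {}"
  then have "[] \<in> F" using assms(2) by fastforce
  then show False using assms(1,3) by (fastforce simp: reach_def)
qed

text \<open>Induction on the length with the threshold free: at s = 0 the bound is 1, and a positive
  threshold cannot be met by the empty word.\<close>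

lemma dens_reach_le:
  fixes x :: real
  assumes "0 \<le> x" "x \<le> 1" "1 + x ^ r \<le> 2 * x" "1 \<le> r"
    and "\<forall>v\<in>F. length v = n" "reach r s F"
  shows "dens n F \<le> x ^ s"
  using assms(5,6)
proof (induction n arbitrary: s F)
  case 0
  show ?case
  proof (cases s)
    case 0
    then show ?thesis using dens_le_1[OF "0.prems"(1)] by simp
  next
    case (Suc k)
    with "0.prems" have "F = {}" by (intro reach_0_empty) auto
    then show ?thesis using assms(1) by simp
  qed
next
  case (Suc n)
  show ?case
  proof (cases s)
    case 0
    then show ?thesis using dens_le_1[OF Suc.prems(1)] by simp
  next
    case (Suc k)
    have l: "\<forall>v\<in>sec [b] F. length v = n" for b using Suc.prems(1) by fastforce
    have "dens n (sec [True] F) \<le> x ^ k"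
      using Suc.IH[OF l sec_True_reach[OF Suc.prems(2)]] Suc by simp
    moreover have "dens n (sec [False] F) \<le> x ^ (k + r)"
      using Suc.IH[OF l sec_False_reach[OF Suc.prems(2)]] Suc assms(4) by simp
    ultimately have "dens (Suc n) F \<le> x ^ k * (1 + x ^ r) / 2"
      unfolding dens_Suc[OF Suc.prems(1)] by (simp add: power_add algebra_simps)
    also have "\<dots> \<le> x ^ k * (2 * x) / 2"
      using assms by (intro divide_right_mono mult_left_mono) auto
    finally show ?thesis using Suc by (simp add: mult.commute)
  qed
qed

text \<open>The same recursion, stopped at the level \<open>s\<^sub>0\<close> where a better bound c
  is known. There c replaces the x^s0 that plain powers would give.\<close>

lemma dens_hits_le:
  fixes x :: real
  assumes x: "0 \<le> x" "x \<le> 1" "1 + x ^ r \<le> 2 * x" "1 \<le> r"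
    and anchor: "\<And>m F. m \<le> n \<Longrightarrow> shifted m F \<Longrightarrow> hits r s\<^sub>0 F \<Longrightarrow> dens m F \<le> c"
    and "0 \<le> c" "1 \<le> s\<^sub>0" "s\<^sub>0 \<le> s"
    and "shifted n F" "hits r s F"
  shows "dens n F \<le> c * x ^ (s - s\<^sub>0)"
  using assms(5,8-)
proof (induction n arbitrary: s F)
  case 0
  have "F = {}"
    using reach_0_empty[OF hits_reach[OF "0.prems"(4)]] "0.prems"(2,3) assms(7)
    by (simp add: shifted_def)
  then show ?case using x \<open>0 \<le> c\<close> by simp
next
  case (Suc n)
  show ?case
  proof (cases "s = s\<^sub>0")
    case True
    then show ?thesis using Suc.prems by simp
  next
    case False
    then obtain k where k: "s - s\<^sub>0 = Suc k" using Suc.prems(2) by (cases "s - s\<^sub>0") auto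
    have sh: "shifted n (sec [b] F)" for b
      using Suc.prems(3) by (intro shifted_sec) simp
    have "dens n (sec [True] F) \<le> c * x ^ (s - 1 - s\<^sub>0)"
      using k by (intro Suc.IH sh sec_True_hits Suc.prems) auto
    moreover have "dens n (sec [False] F) \<le> c * x ^ (s + r - 1 - s\<^sub>0)"
      using k assms(7) x(4) by (intro Suc.IH sh sec_False_hits Suc.prems) auto
    moreover have "s - 1 - s\<^sub>0 = k" "s + r - 1 - s\<^sub>0 = k + r" using k by auto
    moreover have "\<forall>v\<in>F. length v = Suc n" using Suc.prems(3) by (auto simp: shifted_def)
    ultimately have "dens (Suc n) F \<le> c * x ^ k * (1 + x ^ r) / 2"
      by (simp add: dens_Suc power_add algebra_simps)
    also have "\<dots> \<le> c * x ^ k * (2 * x) / 2"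
      using x \<open>0 \<le> c\<close> by (intro divide_right_mono mult_left_mono) auto
    finally show ?thesis using k by (simp add: mult.assoc mult.commute)
  qed
qed

section \<open>Shifted families and the induction statement\<close>

lemma count_list_True_False: "count_list v True + count_list v False = length v"
  by (induction v) auto

text \<open>The prefix counts of p are at most i and at most t - k; the target word attains the
  smaller of the two at every i.\<close>

lemma dominated_replicate_append:
  assumes "length p = t" "k \<le> count_list p False"
  shows "dominated p (replicate (t - k) True @ replicate k False)"
  unfolding dominated_def
proof (intro conjI allI)
  have "k \<le> t" using assms count_list_True_False[of p] by linarith
  then show "length p = length (replicate (t - k) True @ replicate k False)" using assms by simp
  fix i
  have "cnt p i \<le> cnt p (max i t)" by (rule cnt_mono) simp
  also have "\<dots> = count_list p True" using assms by (simp add: cnt_def)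
  also have "\<dots> \<le> t - k" using assms count_list_True_False[of p] by linarith
  finally show "cnt p i \<le> cnt (replicate (t - k) True @ replicate k False) i"
    using cnt_le[of p i] by (simp add: cnt_append)
qed

lemma shifted_replicate:
  assumes "shifted n F" "p @ v \<in> F" "k \<le> count_list p False"
  shows "replicate (length p - k) True @ replicate k False @ replicate (length v) True \<in> F"
  using shiftedD[OF assms(1,2) dominated_append[OF dominated_replicate_append[OF refl assms(3)]
    dominated_replicate[of v]]] by simp

text \<open>For r copies of this word the condition is (r - 1) i + t <= r (i - 1), so i >= r + t;
  the saturation of \<open>cnt\<close> turns this into a bound on n.\<close>

lemma nontrivial_length:
  assumes "shifted n F" "hits r t F" "1 \<le> t" "1 \<le> r" "False # replicate (n - 1) True \<in> F"
  shows "r + t \<le> n"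
proof -
  have n: "1 \<le> n" using shifted_length[OF assms(1,5)] by simp
  obtain i where i: "(r - 1) * i + t \<le> r * cnt (False # replicate (n - 1) True) i"
    using hits_reach[OF assms(2)] assms(5) unfolding reach_def by blast
  obtain k where k: "i = Suc k" using i assms(3) by (cases i) auto
  obtain q where q: "r = Suc q" using assms(4) by (cases r) auto
  have "q * Suc k + t \<le> Suc q * min k (n - 1)" using i k q by simp
  moreover have "q * min k (n - 1) \<le> q * k" by simp
  moreover have "q * Suc k = q + q * k" "Suc q * min k (n - 1) = min k (n - 1) + q * min k (n - 1)"
    by simp_all
  ultimately have "q + t \<le> min k (n - 1)" by linarith
  then show ?thesis using n q by linarith
qed

text \<open>The membership premise is non-triviality: in a shifted family it puts every word with
  exactly one \<open>False\<close> into F. The word in the equality clause generates the extremal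
  family, as the words dominating it are those with at most one \<open>False\<close> among the first
  r + t letters.\<close>

definition ext_bound :: "nat \<Rightarrow> nat \<Rightarrow> bool" where
  "ext_bound r n \<longleftrightarrow> (\<forall>t F. 1 \<le> t \<longrightarrow> t < 2 ^ r - r - 1 \<longrightarrow> shifted n F \<longrightarrow> hits r t F \<longrightarrow>
     False # replicate (n - 1) True \<in> F \<longrightarrow>
     dens n F \<le> real (r + t + 1) / 2 ^ (r + t) \<and>
     (dens n F = real (r + t + 1) / 2 ^ (r + t) \<longrightarrow>
       False # replicate (r + t - 1) True @ replicate (n - r - t) False \<in> F))"

lemma ext_boundD:
  assumes "ext_bound r n" "1 \<le> t" "t < 2 ^ r - r - 1" "shifted n F" "hits r t F"
    and "False # replicate (n - 1) True \<in> F"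
  shows "dens n F \<le> real (r + t + 1) / 2 ^ (r + t)"
    and "dens n F = real (r + t + 1) / 2 ^ (r + t) \<Longrightarrow>
      False # replicate (r + t - 1) True @ replicate (n - r - t) False \<in> F"
  using assms unfolding ext_bound_def by blast+

lemma two_r_less: "3 \<le> (r::nat) \<Longrightarrow> 2 * r + 1 < 2 ^ r"
  by (induction r rule: dec_induct) auto

text \<open>If F contains the word with one leading \<open>False\<close>, then
  \<open>ext_bound\<close> puts the density strictly below 1 / 2^s, because r + s + 1 < 2^r.
  Otherwise all words start with \<open>True\<close>, and removing that letter lowers s by 1 and
  doubles the density. So equality forces all s letters to be removed in this way.\<close>

lemma dens_anchor:
  assumes "3 \<le> r" "\<And>m. m \<le> n \<Longrightarrow> ext_bound r m" "s \<le> r" "shifted n F" "hits r s F"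
  shows "dens n F \<le> 1 / 2 ^ s \<and>
    (dens n F = 1 / 2 ^ s \<longrightarrow> replicate s True @ replicate (n - s) False \<in> F)"
  using assms(2-)
proof (induction n arbitrary: s F)
  case 0
  show ?case
  proof (cases s)
    case 0
    then show ?thesis
      using dens_le_1[of F 0] dens_eq_1[of F 0] "0.prems"(3) by (auto simp: shifted_def)
  next
    case (Suc k)
    with "0.prems" have "F = {}"
      using reach_0_empty[OF hits_reach[OF "0.prems"(4)]] by (simp add: shifted_def)
    then show ?thesis by simp
  qed
next
  case (Suc n)
  have l: "\<forall>v\<in>F. length v = Suc n" using Suc.prems(3) by (auto simp: shifted_def)
  have r: "s < 2 ^ r - r - 1" "r + s + 1 < 2 ^ r"
    using two_r_less[OF assms(1)] Suc.prems(2) by auto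
  show ?case
  proof (cases s)
    case 0
    then show ?thesis using dens_le_1[OF l] dens_eq_1[OF l] by auto
  next
    case s: (Suc k)
    show ?thesis
    proof (cases "False # replicate n True \<in> F")
      case True
      then have "dens (Suc n) F \<le> real (r + s + 1) / 2 ^ (r + s)"
        using Suc.prems r s by (intro ext_boundD(1)) auto
      also have "\<dots> < 2 ^ r / 2 ^ (r + s)"
      proof (rule divide_strict_right_mono)
        have "real (r + s + 1) < real (2 ^ r)" using r(2) by (simp only: of_nat_less_iff)
        then show "real (r + s + 1) < 2 ^ r" by simp
      qed simp
      finally show ?thesis by (simp add: power_add)
    next
      case False
      have "sec [False] F = {}"
        using False shiftedD[OF Suc.prems(3) _ dominated_Cons[OF dominated_replicate]] l by fastforce
      then have d: "dens (Suc n) F = dens n (sec [True] F) / 2"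
        by (simp add: dens_Suc[OF l])
      have IH: "dens n (sec [True] F) \<le> 1 / 2 ^ k \<and>
        (dens n (sec [True] F) = 1 / 2 ^ k \<longrightarrow>
          replicate k True @ replicate (n - k) False \<in> sec [True] F)"
        using s Suc.prems sec_True_hits[OF Suc.prems(4)]
        by (intro Suc.IH shifted_sec) auto
      then show ?thesis unfolding d using s by (auto simp: field_simps)
    qed
  qed
qed

text \<open>One of the r words is set to u. A prefix i <= t cannot serve: the others contribute at
  most i each and u fewer than t. In longer prefixes u has at least k letters \<open>False\<close>,
  for which the other r - 1 words must make up.\<close>

lemma hits_drop:
  assumes "hits r t F" "2 \<le> r" "u \<in> F"
    and u: "cnt u t < t" "\<And>i. cnt u (t + i) + k \<le> t + i"
  shows "hits (r - 1) k (sec (replicate t True) F)"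
  unfolding hits_def
proof (intro allI impI)
  fix vs assume v: "\<forall>j<r - 1. vs j \<in> sec (replicate t True) F"
  obtain q where q: "r = Suc (Suc q)" using assms(2) by (metis add_2_eq_Suc le_Suc_ex)
  define ws where "ws j = (if j < r - 1 then replicate t True @ vs j else u)" for j
  have "\<forall>j<r. ws j \<in> F" using v assms(3) by (auto simp: ws_def)
  then obtain i where i: "(r - 1) * i + t \<le> (\<Sum>j<r. cnt (ws j) i)"
    using assms(1)[unfolded hits_def, rule_format, of ws] by blast
  also have "(\<Sum>j<r. cnt (ws j) i) = (\<Sum>j<r-1. cnt (replicate t True @ vs j) i) + cnt u i"
    by (simp add: q ws_def)
  finally have s: "(r - 1) * i + t \<le> (r - 1) * min i t + (\<Sum>j<r-1. cnt (vs j) (i - t)) + cnt u i"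
    by (simp add: cnt_append sum.distrib)
  have "\<not> i \<le> t"
  proof
    assume "i \<le> t"
    then have "cnt u i < t" using u(1) cnt_mono[of i t u] by linarith
    with s \<open>i \<le> t\<close> show False by simp
  qed
  then obtain m where m: "i = t + m" by (metis le_add_diff_inverse nat_le_linear)
  then have "(r - 1) * m + t + k \<le> (\<Sum>j<r-1. cnt (vs j) m) + (t + m)"
    using s u(2)[of m] by (simp add: q algebra_simps)
  then have "(r - 1 - 1) * m + k \<le> (\<Sum>j<r-1. cnt (vs j) m)"
    by (simp add: q algebra_simps)
  then show "\<exists>i. (r - 1 - 1) * i + k \<le> (\<Sum>j<r-1. cnt (vs j) i)" by blast
qed

text \<open>In a prefix of length i a word and its complement have at most i letters
  \<open>True\<close> together, one fewer than required, so at most one of the two is in F.\<close>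

lemma dens_le_half:
  assumes "hits 2 1 F" "\<forall>v\<in>F. length v = n"
  shows "dens n F \<le> 1 / 2"
proof -
  have disj: "F \<inter> map Not ` F = {}"
  proof (rule ccontr)
    assume "F \<inter> map Not ` F \<noteq> {}"
    then obtain v where v: "v \<in> F" "map Not v \<in> F" by auto
    then have "\<exists>i. (2 - 1) * i + 1 \<le> (\<Sum>j<2::nat. cnt (if j = 0 then v else map Not v) i)"
      using assms(1)[unfolded hits_def, rule_format, of "\<lambda>j. if j = 0 then v else map Not v"]
      by simp
    then obtain i where "i + 1 \<le> cnt v i + cnt (map Not v) i"
      by (auto simp: numeral_2_eq_2 lessThan_Suc add.commute)
    have "cnt v i + cnt (map Not v) i \<le> i" for i
    proof (induction v arbitrary: i)
      case (Cons b v)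
      then show ?case by (cases i) auto
    qed simp
    from this[of i] show False using \<open>i + 1 \<le> cnt v i + cnt (map Not v) i\<close> by linarith
  qed
  have "card F + card (map Not ` F) = card (F \<union> map Not ` F)"
    using disj finite_fam[OF assms(2)] by (simp add: card_Un_disjoint)
  also have "\<dots> \<le> card {v :: bool list. length v = n}"
    using assms(2) by (intro card_mono finite_lists) auto
  finally have "card F + card (map Not ` F) \<le> 2 ^ n" by (simp add: card_lists)
  moreover have "card (map Not ` F) = card F"
    by (rule card_image, rule inj_on_subset[OF inj_mapI subset_UNIV]) (simp add: inj_def)
  ultimately have "real (2 * card F) \<le> real (2 ^ n)" by (simp only: of_nat_le_iff)
  then show ?thesis by (simp add: dens_def field_simps)
qed

section \<open>Numerical estimates for the tail\<close>

lemma of_nat_choose_two: "real (t choose 2) = t * (real t - 1) / 2"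
  by (induction t) (simp_all add: numeral_2_eq_2 field_simps)

text \<open>From k = 2 on, consecutive terms have ratio (t - k) \<beta> / (k + 1), which is at most
  (t - 2) \<beta> / 3 <= q. Hence the first term times 1 / (1 - q) is an upper bound.\<close>

lemma binomial_geometric:
  fixes \<beta> q :: real
  assumes "0 \<le> \<beta>" "(real t - 2) * \<beta> / 3 \<le> q" "0 \<le> q" "q < 1"
  shows "(\<Sum>k=2..t. (t choose k) * \<beta> ^ (k - 1)) \<le> t * ((real t - 1) / 2 * \<beta> / (1 - q))"
proof -
  have bound: "(t choose (2 + i)) * \<beta> ^ (1 + i) \<le> (t choose 2) * \<beta> * q ^ i" for i
  proof (induction i)
    case (Suc i)
    show ?case
    proof (cases "2 + i < t")
      case True
      have "Suc (2 + i) * (t choose Suc (2 + i)) = (t - (2 + i)) * (t choose (2 + i))"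
        using binomial_absorb_comp[of t "2 + i"] binomial_absorption[of "2 + i" t]
        by (metis binomial_absorption)
      then have "real (3 + i) * (t choose (3 + i)) = real (t - (2 + i)) * (t choose (2 + i))"
        by (metis (no_types, lifting) Suc_eq_plus1 add.commute add_Suc_shift eval_nat_numeral(3)
            of_nat_mult plus_nat.simps(2))
      then have e: "real (t choose (3 + i)) = (t choose (2 + i)) * (real (t - (2 + i)) / (3 + i))"
        by (simp add: field_simps)
      have "(t choose (3 + i)) * \<beta> ^ (2 + i)
          = ((t choose (2 + i)) * \<beta> ^ (1 + i)) * (real (t - (2 + i)) * \<beta> / (3 + i))"
        unfolding e by simp
      also have "\<dots> \<le> ((t choose 2) * \<beta> * q ^ i) * q"
      proof (rule mult_mono[OF Suc.IH])
        have "real (t - (2 + i)) * \<beta> / (3 + i) \<le> (real t - 2) * \<beta> / 3"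
          using assms(1) True by (intro frac_le mult_right_mono mult_nonneg_nonneg) auto
        then show "real (t - (2 + i)) * \<beta> / (3 + i) \<le> q" using assms(2) by linarith
      qed (use assms in auto)
      finally have "(t choose (3 + i)) * \<beta> ^ (2 + i) \<le> (t choose 2) * \<beta> * q ^ i * q" .
      moreover have "2 + Suc i = 3 + i" "1 + Suc i = 2 + i" by auto
      ultimately show ?thesis by (simp only: power_Suc2 mult.assoc)
    next
      case False
      then have "t choose (2 + Suc i) = 0" by (intro binomial_eq_0) simp
      then show ?thesis using assms by (simp only: of_nat_0 mult_zero_left) simp
    qed
  qed simp
  have "(\<Sum>k=2..t. (t choose k) * \<beta> ^ (k - 1)) = (\<Sum>i<t-1. (t choose (2 + i)) * \<beta> ^ (1 + i))"
  proof (rule sum.reindex_bij_witness[of _ "\<lambda>i. 2 + i" "\<lambda>k. k - 2"])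
    fix k assume "k \<in> {2..t}"
    then obtain i where i: "k = 2 + i" "i \<le> t - 2" "2 \<le> t" by (auto simp: le_iff_add)
    then show "2 + (k - 2) = k" "k - 2 \<in> {..<t - 1}"
      "(t choose (2 + (k - 2))) * \<beta> ^ (1 + (k - 2)) = (t choose k) * \<beta> ^ (k - 1)" by auto
  qed auto
  also have "\<dots> \<le> (\<Sum>i<t-1. (t choose 2) * \<beta> * q ^ i)"
    by (intro sum_mono bound)
  also have "\<dots> = (t choose 2) * \<beta> * (\<Sum>i<t-1. q ^ i)"
    by (simp add: sum_distrib_left)
  also have "\<dots> \<le> (t choose 2) * \<beta> * (1 / (1 - q))"
  proof (intro mult_left_mono)
    have "(\<Sum>i<t-1. q ^ i) = (1 - q ^ (t - 1)) / (1 - q)"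
      using assms by (simp add: sum_gp_strict)
    also have "\<dots> \<le> 1 / (1 - q)" using assms by (intro divide_right_mono) auto
    finally show "(\<Sum>i<t-1. q ^ i) \<le> 1 / (1 - q)" .
  qed (use assms in auto)
  finally show ?thesis by (simp add: of_nat_choose_two)
qed

text \<open>(1 + y)^r (1 - y)^r <= 1, and Bernoulli bounds the second factor below by 1 - r
  y.\<close>

lemma one_plus_power_le:
  fixes y c :: real
  assumes "0 \<le> y" "r * y < 1" "1 / (1 - r * y) \<le> c"
  shows "(1 + y) ^ r \<le> c"
proof (cases "r = 0")
  case False
  then have "1 * y \<le> r * y" using assms(1) by (intro mult_right_mono) auto
  then have y: "y < 1" using assms(2) by simp
  have "1 - r * y \<le> (1 - y) ^ r"
    using Bernoulli_inequality[of "- y" r] y by simp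
  then have "(1 + y) ^ r * (1 - r * y) \<le> (1 + y) ^ r * (1 - y) ^ r"
    using assms(1) by (intro mult_left_mono) auto
  also have "\<dots> = (1 - y\<^sup>2) ^ r"
    by (simp add: power_mult_distrib[symmetric] power2_eq_square algebra_simps)
  also have "\<dots> \<le> 1"
    using y assms(1) by (intro power_le_one) (auto simp: power2_eq_square mult_le_one)
  finally have "(1 + y) ^ r \<le> 1 / (1 - r * y)"
    using assms(2) by (simp add: field_simps)
  then show ?thesis using assms(3) by simp
qed (use assms in auto)

text \<open>The summands bound the section \<open>True ... True\<close> (by \<open>ext_bound\<close>
  for r - 1 and threshold 2), the t sections with one \<open>False\<close> (by
  \<open>ext_bound\<close> with t = r), and the tail. After multiplication by 2^r, subtracting (r +
  2) / 2 from r + t + 1 leaves t + r / 2 for the other two.\<close>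

lemma main_inequality:
  fixes x q \<kappa> :: real
  assumes "2 \<le> t" "0 \<le> x" "(real t - 2) * x ^ r / 3 \<le> q" "0 \<le> q" "q < 1"
    and "(real t - 1) / 2 * x ^ r / (1 - q) \<le> \<kappa>"
    and "real t * (real (2 * r + 1) / 2 ^ r + \<kappa>) < real t + real r / 2"
  shows "real (r + 2) / 2 ^ (r + 1) + real t * (real (2 * r + 1) / 2 ^ (2 * r))
      + 1 / 2 ^ r * (\<Sum>k=2..t. (t choose k) * (x ^ r) ^ (k - 1)) < real (r + t + 1) / 2 ^ r"
proof -
  have "(\<Sum>k=2..t. (t choose k) * (x ^ r) ^ (k - 1)) \<le> t * ((real t - 1) / 2 * x ^ r / (1 - q))"
    using assms by (intro binomial_geometric) auto
  also have "\<dots> \<le> t * \<kappa>" using assms by (intro mult_left_mono) auto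
  finally have b: "(\<Sum>k=2..t. (t choose k) * (x ^ r) ^ (k - 1)) \<le> t * \<kappa>" .
  have "real (r + 2) / 2 ^ (r + 1) + real t * (real (2 * r + 1) / 2 ^ (2 * r))
      + 1 / 2 ^ r * (\<Sum>k=2..t. (t choose k) * (x ^ r) ^ (k - 1))
    = (real (r + 2) / 2 + real t * (real (2 * r + 1) / 2 ^ r)
      + (\<Sum>k=2..t. (t choose k) * (x ^ r) ^ (k - 1))) / 2 ^ r"
    by (simp only: mult_2 power_add power_one_right) (simp only: add_divide_distrib
      times_divide_eq_right divide_divide_eq_left mult_1_left times_divide_eq_left mult.commute)
  also have "\<dots> < real (r + t + 1) / 2 ^ r"
  proof (rule divide_strict_right_mono)
    show "real (r + 2) / 2 + real t * (real (2 * r + 1) / 2 ^ r)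
      + (\<Sum>k=2..t. (t choose k) * (x ^ r) ^ (k - 1)) < real (r + t + 1)"
    proof -
      have arith: "real (r + 2) / 2 + A + B < real (r + t + 1)"
        if "B \<le> C" "A + C < real t + real r / 2" for A B C
        using that by (simp add: field_simps)
      show ?thesis by (rule arith[OF b assms(7)[unfolded distrib_left]])
    qed
  qed simp
  finally show ?thesis .
qed

text \<open>x has to exceed 1/2 slightly to satisfy 1 + x^r <= 2 x, while x^r should stay close to 1
  / 2^r. For r = 4, 5, 6 the largest t are 10, 25, 56, and q and \<kappa> are the values required
  there, rounded up.\<close>

lemma main_numeric:
  assumes "4 \<le> r"
  shows "\<exists>x::real. 0 \<le> x \<and> x \<le> 1 \<and> 1 + x ^ r \<le> 2 * x \<and>
    (\<forall>t. 2 \<le> t \<longrightarrow> t < 2 ^ r - r - 1 \<longrightarrow>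
      real (r + 2) / 2 ^ (r + 1) + real t * (real (2 * r + 1) / 2 ^ (2 * r))
      + 1 / 2 ^ r * (\<Sum>k=2..t. (t choose k) * (x ^ r) ^ (k - 1)) < real (r + t + 1) / 2 ^ r)"
proof -
  consider "r = 4" | "r = 5" | "r = 6" | "7 \<le> r" using assms by linarith
  then show ?thesis
  proof cases
    case 1
    show ?thesis
    proof (intro exI[of _ "11/20"] conjI allI impI)
      fix t :: nat assume "2 \<le> t" and "t < 2 ^ r - r - 1"
      then have t: "2 \<le> real t" "real t \<le> 10" using 1 by auto
      show "real (r + 2) / 2 ^ (r + 1) + real t * (real (2 * r + 1) / 2 ^ (2 * r))
        + 1 / 2 ^ r * (\<Sum>k=2..t. (t choose k) * ((11/20) ^ r) ^ (k - 1)) < real (r + t + 1) / 2 ^ r"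
        by (rule main_inequality[where q = "1/4" and \<kappa> = "11/20"])
           (use t 1 in \<open>auto simp: field_simps power_divide\<close>)
    qed (simp_all add: 1 power_divide)
  next
    case 2
    show ?thesis
    proof (intro exI[of _ "52/100"] conjI allI impI)
      fix t :: nat assume "2 \<le> t" and "t < 2 ^ r - r - 1"
      then have t: "2 \<le> real t" "real t \<le> 25" using 2 by auto
      show "real (r + 2) / 2 ^ (r + 1) + real t * (real (2 * r + 1) / 2 ^ (2 * r))
        + 1 / 2 ^ r * (\<Sum>k=2..t. (t choose k) * ((52/100) ^ r) ^ (k - 1)) < real (r + t + 1) / 2 ^ r"
        by (rule main_inequality[where q = "3/10" and \<kappa> = "131/200"])
           (use t 2 in \<open>auto simp: field_simps power_divide\<close>)
    qed (simp_all add: 2 power_divide)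
  next
    case 3
    show ?thesis
    proof (intro exI[of _ "51/100"] conjI allI impI)
      fix t :: nat assume "2 \<le> t" and "t < 2 ^ r - r - 1"
      then have t: "2 \<le> real t" "real t \<le> 56" using 3 by auto
      show "real (r + 2) / 2 ^ (r + 1) + real t * (real (2 * r + 1) / 2 ^ (2 * r))
        + 1 / 2 ^ r * (\<Sum>k=2..t. (t choose k) * ((51/100) ^ r) ^ (k - 1)) < real (r + t + 1) / 2 ^ r"
        by (rule main_inequality[where q = "33/100" and \<kappa> = "3/4"])
           (use t 3 in \<open>auto simp: field_simps power_divide\<close>)
    qed (simp_all add: 3 power_divide)
  next
    case 4
    \<comment> \<open>(2 r + 1) / 2^r is decreasing and equals 15/128 at r = 7.\<close>
    have "15 * 2 ^ r \<ge> 128 * (2 * r + 1)"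
      using 4 by (induction r rule: dec_induct) auto
    then have "real (128 * (2 * r + 1)) \<le> real (15 * 2 ^ r)" by (simp only: of_nat_le_iff)
    then have r: "128 * (2 * real r + 1) \<le> 15 * 2 ^ r" by simp
    \<comment> \<open>With x = (1 + y) / 2 the condition on x reads x^r <= y, that is (1 + y)^r <=
      2^r y = 11/10. This holds because r y <= 1/11 and 1 / (1 - 1/11) = 11/10.\<close>
    define y :: real where "y = 11/10 / 2 ^ r"
    define x where "x = (1 + y) / 2"
    have y: "0 \<le> y" "y \<le> 1" "real r * y \<le> 1/11"
      using r by (auto simp: y_def field_simps)
    have "(1 + y) ^ r \<le> 11/10"
      using y by (intro one_plus_power_le) (auto simp: field_simps)
    then have "(1 + y) ^ r / 2 ^ r \<le> 11/10 / 2 ^ r" by (rule divide_right_mono) simp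
    then have xy: "x ^ r \<le> y"
      by (simp only: x_def power_divide) (simp only: y_def)
    have x0: "0 \<le> x" "x \<le> 1" using y by (auto simp: x_def)
    show ?thesis
    proof (intro exI[of _ x] conjI allI impI)
      show "1 + x ^ r \<le> 2 * x" using xy by (simp add: x_def)
      fix t :: nat assume "2 \<le> t" and t: "t < 2 ^ r - r - 1"
      then have "real t \<le> real (2 ^ r)" by (simp only: of_nat_le_iff)
      then have "real t * y \<le> 2 ^ r * y" using y by (intro mult_right_mono) auto
      then have ty: "real t * y \<le> 11/10" by (simp add: y_def)
      have tx: "(real t - 2) * x ^ r \<le> 11/10" "(real t - 1) * x ^ r \<le> 11/10"
        using mult_left_mono[OF xy, of "real t"] ty zero_le_power[OF x0(1), of r]
        by (auto simp: algebra_simps)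
      have "(2 * real r + 1) / 2 ^ r \<le> 15/128" using r by (simp add: field_simps)
      then have "t * ((2 * real r + 1) / 2 ^ r + 87/100) \<le> t * (15/128 + 87/100)"
        by (intro mult_left_mono add_right_mono) auto
      also have "\<dots> \<le> t" by simp
      also have "\<dots> < t + r / 2" using 4 by simp
      finally have fin: "real t * (real (2 * r + 1) / 2 ^ r + 87/100) < real t + real r / 2" by (simp add: add.commute)
      \<comment> \<open>Both constants come from t y <= 11/10: 11/30 is a third of it, and half of
        it divided by 1 - 11/30 is 33/38 < 87/100. The margin is 15/128 + 87/100 < 1.\<close>
      show "real (r + 2) / 2 ^ (r + 1) + real t * (real (2 * r + 1) / 2 ^ (2 * r))
        + 1 / 2 ^ r * (\<Sum>k=2..t. (t choose k) * (x ^ r) ^ (k - 1)) < real (r + t + 1) / 2 ^ r"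
        by (rule main_inequality[where q = "11/30" and \<kappa> = "87/100"])
           (use \<open>2 \<le> t\<close> tx x0 fin in \<open>auto simp: field_simps\<close>)
    qed (use x0 in auto)
  qed
qed

section \<open>The extremal bound for shifted families\<close>

lemma count_list_replicate_same: "count_list (replicate n b) c = (if b = c then n else 0)"
  by (induction n) auto

lemma replicate_True_iff: "count_list p False = 0 \<longleftrightarrow> p = replicate (length p) True"
  by (induction p) auto

lemma sum_cut:
  fixes g s c b :: real
  assumes "1 \<le> t"
  shows "(\<Sum>k\<le>t. (t choose k) * (if k = 0 then g else if k = 1 then s else c * b ^ (k - 1)))
    = g + t * s + c * (\<Sum>k=2..t. (t choose k) * b ^ (k - 1))"
proof -
  let ?f = "\<lambda>k. (t choose k) * (if k = 0 then g else if k = 1 then s else c * b ^ (k - 1))"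
  have "{..t} = {0, 1} \<union> {2..t}" using assms by auto
  then have "sum ?f {..t} = sum ?f {0, 1} + sum ?f {2..t}"
    by (simp only:) (rule sum.union_disjoint; auto)
  moreover have "sum ?f {2..t} = (\<Sum>k=2..t. c * ((t choose k) * b ^ (k - 1)))"
    by (intro sum.cong) auto
  ultimately show ?thesis by (simp add: sum_distrib_left)
qed

section \<open>Cutting a family after its first t letters\<close>

context
  fixes r t m :: nat and F :: "bool list set"
  assumes r: "3 \<le> r" and t: "1 \<le> t" and sh: "shifted (t + m) F" and hF: "hits r t F"
    and nt: "False # replicate (t + m - 1) True \<in> F"
    and IH: "\<And>k. k \<le> m \<Longrightarrow> ext_bound r k"
begin

lemma r_le_m: "r \<le> m"
  using nontrivial_length[OF sh hF t _ nt] r by linarith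

lemma len_F: "\<forall>v\<in>F. length v = t + m"
  using sh by (simp add: shifted_def)

lemma shifted_sec_t: "length p = t \<Longrightarrow> shifted m (sec p F)"
  using shifted_sec[of p m F] sh by simp

lemma len_sec: "length p = t \<Longrightarrow> \<forall>v\<in>sec p F. length v = m"
  using shifted_sec_t by (simp add: shifted_def)

lemma hits_sec_t: "length p = t \<Longrightarrow> hits r (r * count_list p False) (sec p F)"
  using hits_sec[OF hF, of p] r by simp

lemma single_le:
  assumes "length p = t" "count_list p False = 1"
  shows "dens m (sec p F) \<le> 1 / 2 ^ r \<and>
    (dens m (sec p F) = 1 / 2 ^ r \<longrightarrow> replicate r True @ replicate (m - r) False \<in> sec p F)"
  using hits_sec_t[of p] assms
  by (intro dens_anchor[OF r IH] shifted_sec_t) auto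

lemma anchor_tail:
  fixes x :: real
  assumes "0 \<le> x" "x \<le> 1" "1 + x ^ r \<le> 2 * x" "k \<le> m" "shifted k G" "hits r s G" "r \<le> s"
  shows "dens k G \<le> 1 / 2 ^ r * x ^ (s - r)"
proof (rule dens_hits_le[OF assms(1-3)])
  fix l G assume "l \<le> k" "shifted l G" "hits r r G"
  then show "dens l G \<le> 1 / 2 ^ r"
    using dens_anchor[of r l r G] r IH \<open>k \<le> m\<close> by auto
qed (use assms r in auto)

text \<open>k letters \<open>False\<close> leave the threshold r k. The first r units are paid by
  the anchor 1 / 2^r, every further r units by a factor x^r.\<close>

lemma tail_le:
  fixes x :: real
  assumes "0 \<le> x" "x \<le> 1" "1 + x ^ r \<le> 2 * x" "length p = t" "1 \<le> count_list p False"
  shows "dens m (sec p F) \<le> 1 / 2 ^ r * (x ^ r) ^ (count_list p False - 1)"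
proof -
  have "dens m (sec p F) \<le> 1 / 2 ^ r * x ^ (r * count_list p False - r)"
    using assms by (intro anchor_tail shifted_sec_t hits_sec_t) auto
  also have "r * count_list p False - r = r * (count_list p False - 1)"
    by (simp add: right_diff_distrib')
  finally show ?thesis by (simp add: power_mult)
qed

lemma full_nontrivial: "False # replicate (m - 1) True \<in> sec (replicate t True) F"
proof -
  have "False # replicate (t + m - 1) True = (False # replicate t True) @ replicate (m - 1) True"
    using r_le_m r by (simp flip: replicate_add)
  then have "(False # replicate t True) @ replicate (m - 1) True \<in> F" using nt by simp
  from shifted_replicate[OF sh this, of 1] show ?thesis by simp
qed

lemma full_hits: "hits (r - 1) 1 (sec (replicate t True) F)"
proof (rule hits_drop[OF hF _ nt])
  obtain k where k: "t = Suc k" using t by (cases t) auto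
  show "cnt (False # replicate (t + m - 1) True) t < t"
    and "cnt (False # replicate (t + m - 1) True) (t + i) + 1 \<le> t + i" for i
    by (simp_all add: k)
qed (use r in auto)

lemma no_pair:
  assumes "t \<ge> 2 \<Longrightarrow> replicate (t - 2) True @ replicate 2 False @ replicate m True \<notin> F"
    and "length p = t" "2 \<le> count_list p False"
  shows "sec p F = {}"
proof (rule ccontr)
  assume "sec p F \<noteq> {}"
  then obtain v where v: "p @ v \<in> F" by auto
  then have "length v = m" using len_F assms(2) by fastforce
  with shifted_replicate[OF sh v assms(3)] assms show False
    using count_list_True_False[of p] by auto
qed

text \<open>With all sections beyond one \<open>False\<close> empty, (r + 1) / 2^r and t times 1 /
  2^r add up exactly to the target. Equality forces density 1 / 2^r in the section with a leading
  \<open>False\<close>, and the word supplied there by \<open>dens_anchor\<close> completes to the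
  extremal one.\<close>

lemma no_pair_bound:
  assumes "t \<ge> 2 \<Longrightarrow> replicate (t - 2) True @ replicate 2 False @ replicate m True \<notin> F"
    and full: "dens m (sec (replicate t True) F) \<le> real (r + 1) / 2 ^ r"
  shows "dens (t + m) F \<le> real (r + t + 1) / 2 ^ (r + t) \<and>
    (dens (t + m) F = real (r + t + 1) / 2 ^ (r + t) \<longrightarrow>
      False # replicate (r + t - 1) True @ replicate (m - r) False \<in> F)"
proof -
  \<comment> \<open>The factor 0 writes the vanishing tail in the form that \<open>sum_cut\<close>
    expects.\<close>
  define \<sigma> where "\<sigma> k = (if k = 0 then real (r + 1) / 2 ^ r else if k = 1 then 1 / 2 ^ r
    else 0 * (0::real) ^ (k - 1))" for k :: nat
  have \<sigma>: "dens m (sec p F) \<le> \<sigma> (count_list p False)" if p: "length p = t" for p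
  proof -
    consider "count_list p False = 0" | "count_list p False = 1" | "2 \<le> count_list p False"
      by linarith
    then show ?thesis
    proof cases
      case 1
      then show ?thesis using full p replicate_True_iff[of p] by (simp add: \<sigma>_def)
    next
      case 2
      then show ?thesis using single_le[OF p] by (simp add: \<sigma>_def)
    next
      case 3
      then show ?thesis using no_pair[OF assms(1) p] by (simp add: \<sigma>_def)
    qed
  qed
  have sum: "(\<Sum>k\<le>t. (t choose k) * \<sigma> k) / 2 ^ t = real (r + t + 1) / 2 ^ (r + t)"
    unfolding \<sigma>_def sum_cut[OF t] by (simp add: power_add field_simps)
  define p where "p = False # replicate (t - 1) True"
  have p: "length p = t" "count_list p False = 1"
    using t by (auto simp: p_def count_list_replicate_same)
  have "dens m (sec p F) < \<sigma> 1 \<or> replicate r True @ replicate (m - r) False \<in> sec p F"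
    using single_le[OF p] by (auto simp: \<sigma>_def)
  moreover have "p @ replicate r True = False # replicate (r + t - 1) True"
    using t by (simp add: p_def add.commute flip: replicate_add)
  moreover have "dens (t + m) F \<le> real (r + t + 1) / 2 ^ (r + t)"
    unfolding sum[symmetric] by (rule dens_cut(1)[OF len_F \<sigma>])
  moreover have "dens (t + m) F < real (r + t + 1) / 2 ^ (r + t)" if "dens m (sec p F) < \<sigma> 1"
    unfolding sum[symmetric] by (rule dens_cut(2)[OF len_F \<sigma> p(1)]) (use that p in auto)
  ultimately show ?thesis by (auto simp flip: append_assoc)
qed

context
  assumes t2: "2 \<le> t" and pair: "replicate (t - 2) True @ replicate 2 False @ replicate m True \<in> F"
begin

text \<open>The word \<open>pair\<close> has two letters \<open>False\<close> before the cut, so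
  fixing it leaves threshold 2 for the other r - 1 words, where the word of \<open>nt\<close> leaves
  only 1.\<close>

lemma full_hits_pair: "hits (r - 1) 2 (sec (replicate t True) F)"
proof (rule hits_drop[OF hF _ pair])
  obtain k where k: "t = Suc (Suc k)" using t2 by (metis add_2_eq_Suc le_Suc_ex)
  show "cnt (replicate (t - 2) True @ replicate 2 False @ replicate m True) t < t"
    and "cnt (replicate (t - 2) True @ replicate 2 False @ replicate m True) (t + i) + 2 \<le> t + i" for i
    by (simp_all add: k cnt_append)
qed (use r in auto)

lemma single_sec:
  assumes "length p = t" "count_list p False = 1"
  shows "sec p F \<subseteq> sec (replicate (t - 1) True @ [False]) F"
proof
  fix v assume "v \<in> sec p F"
  then have v: "p @ v \<in> F" by simp
  have "dominated p (replicate (t - 1) True @ replicate 1 False)"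
    using assms by (intro dominated_replicate_append) auto
  from shiftedD[OF sh v dominated_append[OF this dominated_refl]]
  show "v \<in> sec (replicate (t - 1) True @ [False]) F" by simp
qed

text \<open>Moving the second \<open>False\<close> of \<open>pair\<close> across the cut shows that
  the largest section with one \<open>False\<close> is itself non-trivial. Its bound drops from 1 /
  2^r to (2 r + 1) / 2^(2 r).\<close>

lemma single_nontrivial: "False # replicate (m - 1) True \<in> sec (replicate (t - 1) True @ [False]) F"
proof -
  obtain k where k: "t = Suc (Suc k)" using t2 by (metis add_2_eq_Suc le_Suc_ex)
  obtain l where l: "m = Suc l" using r_le_m r by (cases m) auto
  have "replicate (t - 2) True @ replicate 2 False @ replicate m True
    = (replicate k True @ [False, False, True]) @ replicate l True"
    by (simp add: k l numeral_2_eq_2)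
  then have "(replicate k True @ [False, False, True]) @ replicate l True \<in> F" using pair by simp
  from shifted_replicate[OF sh this, of 2] show ?thesis
    by (simp add: k l numeral_2_eq_2)
qed

lemma single_pair_le:
  assumes "length p = t" "count_list p False = 1"
  shows "dens m (sec p F) \<le> real (2 * r + 1) / 2 ^ (2 * r)"
proof -
  let ?p = "replicate (t - 1) True @ [False]"
  have p: "length ?p = t" "count_list ?p False = 1"
    using t2 by (auto simp: count_list_replicate_same)
  have "dens m (sec p F) \<le> dens m (sec ?p F)"
    by (intro dens_mono single_sec assms len_sec p)
  moreover have "r < 2 ^ r - r - 1" using two_r_less[OF r] by linarith
  then have "dens m (sec ?p F) \<le> real (r + r + 1) / 2 ^ (r + r)"
    using hits_sec_t[OF p(1)] r
    by (intro ext_boundD(1)[OF IH _ _ shifted_sec_t[OF p(1)] _ single_nontrivial]) (simp_all only: p, simp_all)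
  ultimately show ?thesis unfolding mult_2 by linarith
qed

text \<open>g and s stay free because r = 3 needs other section bounds than larger r.\<close>

lemma pair_bound:
  fixes x g s :: real
  assumes "0 \<le> x" "x \<le> 1" "1 + x ^ r \<le> 2 * x"
    and "dens m (sec (replicate t True) F) \<le> g"
    and "\<And>p. length p = t \<Longrightarrow> count_list p False = 1 \<Longrightarrow> dens m (sec p F) \<le> s"
    and "g + t * s + 1 / 2 ^ r * (\<Sum>k=2..t. (t choose k) * (x ^ r) ^ (k - 1))
      < real (r + t + 1) / 2 ^ r"
  shows "dens (t + m) F < real (r + t + 1) / 2 ^ (r + t)"
proof -
  define \<sigma> where "\<sigma> k = (if k = 0 then g else if k = 1 then s else 1 / 2 ^ r * (x ^ r) ^ (k - 1))"
    for k :: nat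
  have "dens m (sec p F) \<le> \<sigma> (count_list p False)" if p: "length p = t" for p
    using assms(4) assms(5)[OF p] p replicate_True_iff[of p] tail_le[OF assms(1-3) p]
    by (auto simp: \<sigma>_def)
  then have "dens (t + m) F \<le> (\<Sum>k\<le>t. (t choose k) * \<sigma> k) / 2 ^ t"
    by (rule dens_cut(1)[OF len_F])
  also have "\<dots> = (g + t * s + 1 / 2 ^ r * (\<Sum>k=2..t. (t choose k) * (x ^ r) ^ (k - 1))) / 2 ^ t"
    unfolding \<sigma>_def sum_cut[OF t] ..
  also have "\<dots> < real (r + t + 1) / 2 ^ r / 2 ^ t"
    by (intro divide_strict_right_mono assms) simp
  finally show ?thesis by (simp add: power_add)
qed

lemma pair_bound_ge_4:
  assumes "4 \<le> r" "t < 2 ^ r - r - 1"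
    and "dens m (sec (replicate t True) F) \<le> real (r + 2) / 2 ^ (r + 1)"
  shows "dens (t + m) F < real (r + t + 1) / 2 ^ (r + t)"
proof -
  obtain x :: real where x: "0 \<le> x" "x \<le> 1" "1 + x ^ r \<le> 2 * x"
    and "real (r + 2) / 2 ^ (r + 1) + real t * (real (2 * r + 1) / 2 ^ (2 * r))
      + 1 / 2 ^ r * (\<Sum>k=2..t. (t choose k) * (x ^ r) ^ (k - 1)) < real (r + t + 1) / 2 ^ r"
    using main_numeric[OF assms(1)] t2 assms(2) by auto
  then show ?thesis
    by (intro pair_bound[OF x assms(3) single_pair_le]) auto
qed

text \<open>1/2 + 2 * 7/64 + (5/8)^3 / 8 is just below 6/8. The value 5/8 is slightly above (sqrt 5
  - 1) / 2, the smallest nonnegative solution of 1 + x^3 <= 2 x.\<close>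

lemma pair_bound_3_2:
  assumes "r = 3" "t = 2"
  shows "dens (t + m) F < real (r + t + 1) / 2 ^ (r + t)"
proof (rule pair_bound[where x = "5/8"])
  have "hits 2 1 (sec (replicate t True) F)"
    using hits_weaken[OF full_hits_pair, of 1] assms by simp
  then show "dens m (sec (replicate t True) F) \<le> 1 / 2"
    by (rule dens_le_half[OF _ len_sec]) simp
  show "\<And>p. length p = t \<Longrightarrow> count_list p False = 1 \<Longrightarrow> dens m (sec p F) \<le> 7 / 64"
    using single_pair_le assms by force
qed (use assms in \<open>simp_all add: power_divide\<close>)

text \<open>For \<open>r = t = 3\<close> the separate bounds on the sections do not add up to less than the target. But
  either the section of \<open>TTTFF\<close> has density at most \<open>x^3\<close>, which improves the bound on the section of \<open>TTT\<close>,
  or it contains a word with few letters \<open>True\<close> in every prefix, and intersecting with two copies of that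
  word forces every word in the section of \<open>TTFTT\<close> to be heavy.\<close>

lemma pair_bound_3_3:
  assumes rt: "r = 3" "t = 3"
  shows "dens (t + m) F < real (r + t + 1) / 2 ^ (r + t)"
proof -
  let ?x = "5/8 :: real"
  have x: "0 \<le> ?x" "?x \<le> 1" "1 + ?x ^ r \<le> 2 * ?x" by (simp_all add: rt power_divide)
  have sum3: "(\<Sum>k=2..3. real (3 choose k) * b ^ (k - 1)) = 3 * b + b\<^sup>2" for b :: real
    by (simp add: numeral_3_eq_3 numeral_2_eq_2)
  have k: "m = Suc (Suc (m - 2))" using r_le_m rt by linarith
  define k where "k = m - 2"
  note k = k[folded k_def]
  let ?S = "\<lambda>p. sec p F"
  have shs: "shifted k (?S p)" if "length p = 5" for p
    using shifted_sec[of p k F] sh that rt k by (simp add: add.commute eval_nat_numeral)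
  have shs': "shifted (Suc k) (?S p)" if "length p = 4" for p
    using shifted_sec[of p "Suc k" F] sh that rt k by (simp add: add.commute eval_nat_numeral)
  have l: "\<forall>v\<in>?S p. length v = k" if "length p = 5" for p
    using shs[OF that] by (simp add: shifted_def)
  have l': "\<forall>v\<in>?S p. length v = Suc k" if "length p = 4" for p
    using shs'[OF that] by (simp add: shifted_def)
  have T: "replicate t True = [True, True, True]" by (simp add: rt eval_nat_numeral)
  have G: "hits 2 2 (?S [True, True, True])" using full_hits_pair unfolding T by (simp add: rt)
  have G1: "hits 2 1 (?S [True, True, True, True])"
    using sec_True_hits[OF G] by (simp add: sec_sec)
  have G0: "hits 2 3 (?S [True, True, True, False])"
    using sec_False_hits[OF G] by (simp add: sec_sec)
  have G01: "hits 2 2 (?S [True, True, True, False, True])"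
    using sec_True_hits[OF G0] by (simp add: sec_sec)
  have split: "dens m (?S p) = (dens (Suc k) (?S (p @ [True])) + dens (Suc k) (?S (p @ [False]))) / 2"
    if "length p = 3" for p
    using dens_Suc[of "?S p" "Suc k"] len_sec[of p] that rt by (simp add: sec_sec k)
  have split': "dens (Suc k) (?S p) = (dens k (?S (p @ [True])) + dens k (?S (p @ [False]))) / 2"
    if "length p = 4" for p
    using dens_Suc[OF l'[OF that]] by (simp add: sec_sec)
  \<comment> \<open>TTTT has weight 1/2 and TTTFT weight 1/4, each with density at most 1/2;
    together they give 3/8, and TTTFF remains with weight 1/4.\<close>
  let ?G00 = "?S [True, True, True, False, False]"
  have "dens (Suc k) (?S [True, True, True, True]) \<le> 1 / 2"
    by (rule dens_le_half[OF G1 l']) simp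
  moreover have "dens k (?S [True, True, True, False, True]) \<le> 1 / 2"
    by (rule dens_le_half[OF hits_weaken[OF G01] l]) simp_all
  ultimately have full: "dens m (?S [True, True, True]) \<le> 3 / 8 + dens k ?G00 / 4"
    using split[of "[True, True, True]"] split'[of "[True, True, True, False]"]
    by (simp add: field_simps)
  show ?thesis
  proof (cases "reach 3 3 ?G00")
    case True
    then have "dens k ?G00 \<le> ?x ^ 3"
      using x rt by (intro dens_reach_le[where r = 3] l) auto
    with full have g: "dens m (sec (replicate t True) F) \<le> 3 / 8 + ?x ^ 3 / 4" unfolding T by linarith
    have s: "\<And>p. length p = t \<Longrightarrow> count_list p False = 1 \<Longrightarrow> dens m (sec p F) \<le> 7 / 64"
      using single_pair_le rt by force
    show ?thesis
      by (rule pair_bound[OF x g s]) (simp_all only: rt sum3, simp add: power_divide)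
  next
    case False
    then obtain w where w: "w \<in> ?G00" "\<And>i. 3 * cnt w i < 2 * i + 3"
      unfolding reach_def by (auto simp: not_le)
    have reach: "reach 3 5 (?S [True, True, False, True, True])"
      unfolding reach_def
    proof
      fix v assume v: "v \<in> ?S [True, True, False, True, True]"
      define vs where "vs j = (if j = (0::nat) then [True, True, False, True, True] @ v
        else [True, True, True, False, False] @ w)" for j
      have "\<forall>j<r. vs j \<in> F" using v w by (simp add: vs_def)
      then obtain i where "(r - 1) * i + t \<le> (\<Sum>j<r. cnt (vs j) i)"
        using hF unfolding hits_def by blast
      then have i: "2 * i + 3 \<le> cnt ([True, True, False, True, True] @ v) i
          + 2 * cnt ([True, True, True, False, False] @ w) i"
        by (simp add: rt numeral_3_eq_3 vs_def)
      have "\<not> i < 5"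
      proof
        assume "i < 5"
        then consider "i = 0" | "i = 1" | "i = 2" | "i = 3" | "i = 4" by linarith
        then show False using i by cases (simp_all add: eval_nat_numeral)
      qed
      define l where "l = i - 5"
      have l: "i = Suc (Suc (Suc (Suc (Suc l))))" using \<open>\<not> i < 5\<close> by (simp add: l_def)
      \<comment> \<open>For i = l + 5 the fixed letters contribute 4 + 2 * 3, leaving 2 l + 3 <=
        \<open>cnt v l + 2 * cnt w l\<close>. Three times this, with 3 \<open>cnt w l\<close> <= 2 l
        + 2, gives 2 l + 5 <= 3 \<open>cnt v l\<close>.\<close>
      show "\<exists>i. (3 - 1) * i + 5 \<le> 3 * cnt v i"
        using i w(2)[of l] unfolding l by (intro exI[of _ l]) simp
    qed
    \<comment> \<open>The summands belong to TTFTT, by \<open>reach\<close> with threshold 5, and to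
      TTFTF, TTFFT and TTFFF, by \<open>hits\<close> with thresholds 4, 4 and 7 counted from the
      anchor 3.\<close>
    define s where "s = (?x ^ 5 + ?x / 8 + ?x / 8 + ?x ^ 4 / 8) / 4"
    have h: "hits r 3 (?S [True, True, False])" using hits_sec_t[of "[True, True, False]"] rt by simp
    have h1: "hits r 2 (?S [True, True, False, True])" using sec_True_hits[OF h] by (simp add: sec_sec)
    have h0: "hits r 5 (?S [True, True, False, False])"
      using sec_False_hits[OF h] rt by (simp add: sec_sec)
    have h10: "hits r 4 (?S [True, True, False, True, False])"
      using sec_False_hits[OF h1] rt by (simp add: sec_sec)
    have h01: "hits r 4 (?S [True, True, False, False, True])"
      using sec_True_hits[OF h0] rt by (simp add: sec_sec)
    have h00: "hits r 7 (?S [True, True, False, False, False])"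
      using sec_False_hits[OF h0] rt by (simp add: sec_sec)
    have tail: "dens k (?S p) \<le> ?x ^ (u - 3) / 8" if "length p = 5" "hits r u (?S p)" "3 \<le> u" for p u
      using anchor_tail[OF x _ shs that(2)] that k rt by simp
    have "dens k (?S [True, True, False, True, True]) \<le> ?x ^ 5"
      using x rt by (intro dens_reach_le[OF _ _ _ _ l reach]) auto
    then have "dens m (?S [True, True, False]) \<le> s"
      using tail[OF _ h10] tail[OF _ h01] tail[OF _ h00] split[of "[True, True, False]"]
        split'[of "[True, True, False, True]"] split'[of "[True, True, False, False]"]
      by (simp add: s_def field_simps)
    then have s: "dens m (sec p F) \<le> s" if "length p = t" "count_list p False = 1" for p
      using dens_mono[OF single_sec[OF that] len_sec] rt by (simp add: numeral_2_eq_2)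
    have g: "dens m (sec (replicate t True) F) \<le> 1 / 2"
      unfolding T by (rule dens_le_half[OF hits_weaken[OF G] len_sec]) (simp_all add: rt)
    show ?thesis
      by (rule pair_bound[OF x g s]) (simp_all only: rt sum3 s_def, simp add: power_divide)
  qed
qed

end

end

text \<open>The section \<open>True ... True\<close> is non-trivial for r - 1 words, which lets
  \<open>prev\<close> bound it when r >= 4. For r = 3 complements give 1/2, which is again (r + 1) /
  2^r, and t < 4 leaves only t = 2 and t = 3 once a pair occurs.\<close>

lemma ext_bound_step:
  assumes r: "3 \<le> r" and IH: "\<And>k. k < n \<Longrightarrow> ext_bound r k"
    and prev: "\<And>k. 4 \<le> r \<Longrightarrow> ext_bound (r - 1) k"
  shows "ext_bound r n"
  unfolding ext_bound_def
proof (intro allI impI)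
  fix t F
  assume t: "1 \<le> t" "t < 2 ^ r - r - 1" and F: "shifted n F" "hits r t F"
    and nt: "False # replicate (n - 1) True \<in> F"
  have n: "r + t \<le> n" using nontrivial_length[OF F t(1) _ nt] r by linarith
  define m where "m = n - t"
  have nm: "n = t + m" "r \<le> m" using n by (auto simp: m_def)
  have IH': "k \<le> m \<Longrightarrow> ext_bound r k" for k using IH nm t by auto
  note ctx = r t(1) F[unfolded nm(1)] nt[unfolded nm(1)] IH'
  let ?G = "sec (replicate t True) F"
  have lG: "\<forall>v\<in>?G. length v = m" by (rule len_sec[OF ctx]) auto
  have G: "dens m ?G \<le> real (r - 1 + u + 1) / 2 ^ (r - 1 + u)"
    if "4 \<le> r" "1 \<le> u" "u \<le> 2" "hits (r - 1) u ?G" for u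
  proof -
    have "2 * (r - 1) + 1 < 2 ^ (r - 1)" using that by (intro two_r_less) auto
    then have "u < 2 ^ (r - 1) - (r - 1) - 1" using that by linarith
    then show ?thesis
      by (intro ext_boundD(1)[OF prev[OF that(1)] that(2) _ _ that(4) full_nontrivial[OF ctx]]
          shifted_sec_t[OF ctx]) simp_all
  qed
  show "dens n F \<le> real (r + t + 1) / 2 ^ (r + t) \<and>
    (dens n F = real (r + t + 1) / 2 ^ (r + t) \<longrightarrow>
      False # replicate (r + t - 1) True @ replicate (n - r - t) False \<in> F)"
  proof (cases "2 \<le> t \<and> replicate (t - 2) True @ replicate 2 False @ replicate m True \<in> F")
    case False
    have "dens m ?G \<le> real (r + 1) / 2 ^ r"
    proof (cases "4 \<le> r")
      case True
      with G[of 1] full_hits[OF ctx] show ?thesis by simp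
    next
      case False
      with r have "r = 3" by simp
      with full_hits[OF ctx] show ?thesis using dens_le_half[OF _ lG] by simp
    qed
    then show ?thesis using no_pair_bound[OF ctx] False unfolding nm(1) by auto
  next
    case True
    note ctx' = ctx conjunct1[OF True] conjunct2[OF True]
    have "dens (t + m) F < real (r + t + 1) / 2 ^ (r + t)"
    proof (cases "4 \<le> r")
      case True
      then show ?thesis
        using G[of 2] full_hits_pair[OF ctx'] t(2) by (intro pair_bound_ge_4[OF ctx']) simp_all
    next
      case False
      with r have r3: "r = 3" by simp
      with t(2) True have "t = 2 \<or> t = 3" by auto
      then show ?thesis using pair_bound_3_2[OF ctx' r3] pair_bound_3_3[OF ctx' r3] by auto
    qed
    then show ?thesis unfolding nm(1) by simp
  qed
qed

theorem ext_bound: "3 \<le> r \<Longrightarrow> ext_bound r n"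
proof (induction r arbitrary: n rule: less_induct)
  case outer: (less r)
  show "ext_bound r n" for n
  proof (induction n rule: less_induct)
    case (less n)
    show ?case
      by (rule ext_bound_step[OF outer.prems less.IH outer.IH]) auto
  qed
qed

section \<open>From intersections to prefix counts\<close>

lemma cnt_card: "cnt v i = card {k. k < i \<and> k < length v \<and> v ! k}"
proof -
  have "cnt v i = length (filter id (take i v))"
  proof (induction v arbitrary: i)
    case (Cons b v)
    then show ?case by (cases i) auto
  qed simp
  also have "\<dots> = card {k. k < i \<and> k < length v \<and> v ! k}"
    unfolding length_filter_conv_card by (intro arg_cong[of _ _ card]) auto
  finally show ?thesis .
qed

text \<open>Greedy assignment: position \<open>k\<close> receives a token of a class \<open>c k\<close> that still has
  an unused token at or before \<open>k\<close>.\<close>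

lemma token_assignment:
  fixes a :: "nat \<Rightarrow> nat \<Rightarrow> nat"
  assumes "1 \<le> t" "\<And>j. mono (a j)" "\<And>i. i \<le> n \<Longrightarrow> i < (\<Sum>j<r. a j i) + t"
  shows "\<exists>c. (\<forall>k. t - 1 \<le> k \<and> k < n \<longrightarrow> c k < r) \<and>
    (\<forall>j<r. \<forall>i\<le>n. card {k. t - 1 \<le> k \<and> k < i \<and> c k = j} \<le> a j i)"
  using assms(3)
proof (induction n)
  case 0
  show ?case by (intro exI[of _ "\<lambda>_. 0"]) auto
next
  case (Suc n)
  have "\<exists>c. (\<forall>k. t - 1 \<le> k \<and> k < n \<longrightarrow> c k < r) \<and>
    (\<forall>j<r. \<forall>i\<le>n. card {k. t - 1 \<le> k \<and> k < i \<and> c k = j} \<le> a j i)"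
    by (rule Suc.IH) (use Suc.prems in auto)
  then obtain c where c: "\<And>k. t - 1 \<le> k \<Longrightarrow> k < n \<Longrightarrow> c k < r"
    "\<And>j i. j < r \<Longrightarrow> i \<le> n \<Longrightarrow> card {k. t - 1 \<le> k \<and> k < i \<and> c k = j} \<le> a j i"
    by blast
  let ?C = "\<lambda>c i j. {k. t - 1 \<le> k \<and> k < i \<and> c k = (j::nat)}"
  show ?case
  proof (cases "n < t - 1")
    case True
    show ?thesis
    proof (intro exI[of _ c] conjI allI impI)
      fix j i assume "i \<le> Suc n"
      then have "?C c i j = {}" using True by auto
      then show "card (?C c i j) \<le> a j i" by (simp only: card.empty)
    qed (use True in auto)
  next
    case False
    \<comment> \<open>The positions t - 1, ..., n - 1 have used n - (t - 1) tokens, fewer than are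
      available up to position n; so some class has one left.\<close>
    have "(\<Sum>j<r. card (?C c n j)) = card (\<Union>j<r. ?C c n j)"
      by (rule card_UN_disjoint[symmetric]) auto
    also have "(\<Union>j<r. ?C c n j) = {t - 1..<n}" using c(1) by auto
    finally have "(\<Sum>j<r. card (?C c n j)) < (\<Sum>j<r. a j (Suc n))"
      using Suc.prems[of "Suc n"] False assms(1) by simp
    then obtain j where j: "j < r" "card (?C c n j) < a j (Suc n)"
      using sum_mono[of "{..<r}" "\<lambda>j. a j (Suc n)" "\<lambda>j. card (?C c n j)"]
      by (auto simp: not_le[symmetric])
    define c' where "c' = c(n := j)"
    have eq: "?C c' i l = ?C c i l" if "i \<le> n" for i l
      using that by (auto simp: c'_def)
    have eq': "?C c' (Suc n) l = (if l = j then insert n (?C c n l) else ?C c n l)" for l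
      using False by (auto simp: c'_def less_Suc_eq)
    show ?thesis
    proof (intro exI[of _ c'] conjI allI impI)
      fix k assume "t - 1 \<le> k \<and> k < Suc n"
      then show "c' k < r" using c(1)[of k] j by (auto simp: c'_def)
    next
      fix l i assume l: "l < r" "i \<le> Suc n"
      show "card (?C c' i l) \<le> a l i"
      proof (cases "i \<le> n")
        case True
        then show ?thesis using c(2)[OF l(1) True] eq by simp
      next
        case False
        then have i: "i = Suc n" using l by simp
        have "card (?C c n l) \<le> a l (Suc n)"
          using c(2)[OF l(1), of n] monoD[OF assms(2)[of l], of n "Suc n"] by simp
        then show ?thesis
          unfolding i eq' using j by (auto simp: card_insert_if)
      qed
    qed
  qed
qed

text \<open>If every prefix fails, the first i letters of the r words contain at least i - t + 1
  letters \<open>False\<close> in total, enough to move one to each position from t - 1 on. The new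
  words dominate the old ones, so they lie in F, but they share at most t - 1 letters
  \<open>True\<close>.\<close>

lemma hits_of_intersecting:
  assumes sh: "shifted n F" and "1 \<le> t" "1 \<le> r"
    and int: "\<And>vs. (\<And>j. j < r \<Longrightarrow> vs j \<in> F) \<Longrightarrow> t \<le> card {k. k < n \<and> (\<forall>j<r. vs j ! k)}"
  shows "hits r t F"
  unfolding hits_def
proof (intro allI impI)
  fix vs assume vs: "\<forall>j<r. vs j \<in> F"
  show "\<exists>i. (r - 1) * i + t \<le> (\<Sum>j<r. cnt (vs j) i)"
  proof (rule ccontr)
    assume "\<not> ?thesis"
    then have small: "(\<Sum>j<r. cnt (vs j) i) < (r - 1) * i + t" for i by (meson not_le)
    define a where "a j i = i - cnt (vs j) i" for j i
    have "mono (a j)" for j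
      unfolding mono_iff_le_Suc
    proof
      fix i
      have "cnt (vs j) (Suc i) \<le> Suc (cnt (vs j) i)"
        by (cases "i < length (vs j)") (simp_all add: cnt_def take_Suc_conv_app_nth)
      then show "a j i \<le> a j (Suc i)" by (simp add: a_def)
    qed
    moreover have "i < (\<Sum>j<r. a j i) + t" for i
    proof -
      have "(\<Sum>j<r. a j i) + (\<Sum>j<r. cnt (vs j) i) = (\<Sum>j<r. i)"
        unfolding sum.distrib[symmetric] by (intro sum.cong) (auto simp: a_def cnt_le)
      moreover have "r * i = (r - 1) * i + i" using assms(3) by (cases r) auto
      ultimately show ?thesis using small[of i] by simp
    qed
    ultimately obtain c where c: "\<And>k. t - 1 \<le> k \<Longrightarrow> k < n \<Longrightarrow> c k < r"
      "\<And>j i. j < r \<Longrightarrow> i \<le> n \<Longrightarrow> card {k. t - 1 \<le> k \<and> k < i \<and> c k = j} \<le> a j i"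
      using token_assignment[OF assms(2), of a n r] by blast
    define ws where "ws j = map (\<lambda>k. \<not> (t - 1 \<le> k \<and> c k = j)) [0..<n]" for j
    have "ws j \<in> F" if j: "j < r" for j
    proof (rule shiftedD[OF sh])
      have l: "length (vs j) = n" "length (ws j) = n"
        using vs j shifted_length[OF sh] by (auto simp: ws_def)
      have le: "cnt (vs j) i \<le> cnt (ws j) i" if i: "i \<le> n" for i
      proof -
        have "{k. k < i \<and> k < length (ws j) \<and> ws j ! k} = {..<i} - {k. t - 1 \<le> k \<and> k < i \<and> c k = j}"
          using i by (auto simp: ws_def)
        moreover have "card ({..<i} - {k. t - 1 \<le> k \<and> k < i \<and> c k = j})
            = i - card {k. t - 1 \<le> k \<and> k < i \<and> c k = j}"
          by (subst card_Diff_subset) auto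
        ultimately have "cnt (ws j) i = i - card {k. t - 1 \<le> k \<and> k < i \<and> c k = j}"
          by (simp only: cnt_card)
        then show ?thesis using c(2)[OF j i] cnt_le[of "vs j" i] by (simp add: a_def)
      qed
      show "dominated (vs j) (ws j)"
        unfolding dominated_def
      proof (intro conjI allI)
        show "cnt (vs j) i \<le> cnt (ws j) i" for i
          using le[of i] le[of n] l cnt_length[of "vs j" i] cnt_length[of "ws j" i]
          by (cases "i \<le> n") auto
      qed (use l in simp)
      show "vs j \<in> F" using vs j by simp
    qed
    then have "t \<le> card {k. k < n \<and> (\<forall>j<r. ws j ! k)}" by (rule int)
    also have "\<dots> \<le> card {..<t - 1}"
    proof (intro card_mono subsetI)
      fix k assume "k \<in> {k. k < n \<and> (\<forall>j<r. ws j ! k)}"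
      then have k: "k < n" "\<And>j. j < r \<Longrightarrow> k < t - 1 \<or> c k \<noteq> j" by (auto simp: ws_def)
      then show "k \<in> {..<t - 1}" using c(1)[of k] k(2)[of "c k"]
        by (cases "k < t - 1") (simp_all add: not_less)
    qed simp
    finally show False using assms(2) by simp
  qed
qed

text \<open>The two moves generate the prefix order. In the induction on the target word, a missing
  leading \<open>True\<close> is taken from the first \<open>True\<close> of the source, or made by
  raising if there is none.\<close>

lemma shiftedI:
  assumes "\<forall>v\<in>F. length v = n"
    and "\<And>u w. u @ False # w \<in> F \<Longrightarrow> u @ True # w \<in> F"
    and "\<And>u w z. u @ False # w @ True # z \<in> F \<Longrightarrow> u @ True # w @ False # z \<in> F"
  shows "shifted n F"
  unfolding shifted_def
proof (intro conjI ballI allI impI)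
  fix v w assume "v \<in> F" "dominated v w"
  moreover have "\<forall>u x. u @ False # x \<in> F \<longrightarrow> u @ True # x \<in> F"
    and "\<forall>u x z. u @ False # x @ True # z \<in> F \<longrightarrow> u @ True # x @ False # z \<in> F"
    using assms(2,3) by auto
  ultimately show "w \<in> F"
  proof (induction w arbitrary: v F)
    case Nil
    then show ?case by (simp add: dominated_def)
  next
    case (Cons b w)
    obtain a v' where v: "v = a # v'" using Cons.prems(2) by (cases v) (auto simp: dominated_def)
    have IH: "b # w \<in> F" if "b # v'' \<in> F" "dominated v'' w" for v''
    proof -
      have "w \<in> sec [b] F"
      proof (rule Cons.IH)
        show "\<forall>u x. u @ False # x \<in> sec [b] F \<longrightarrow> u @ True # x \<in> sec [b] F"
          using Cons.prems(3)[rule_format, of "b # _"] by auto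
        show "\<forall>u x z. u @ False # x @ True # z \<in> sec [b] F \<longrightarrow> u @ True # x @ False # z \<in> sec [b] F"
          using Cons.prems(4)[rule_format, of "b # _"] by auto
      qed (use that in auto)
      then show ?thesis by simp
    qed
    have cnts: "of_bool a + cnt v' i \<le> of_bool b + cnt w i" for i
      using Cons.prems(2) unfolding v dominated_def by (metis cnt_Cons)
    have len: "length v' = length w" using Cons.prems(2) by (simp add: v dominated_def)
    show ?case
    proof (cases "a = b")
      case True
      then show ?thesis
        using IH[of v'] Cons.prems(1) cnts len by (auto simp: v dominated_def)
    next
      case False
      with cnts[of 0] have ab: "\<not> a" "b" by auto
      show ?thesis
      proof (cases "True \<in> set v'")
        case True
        then obtain x z where xz: "v' = x @ True # z" "True \<notin> set x" by (metis split_list_first)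
        have x: "cnt x i = 0" for i
          unfolding cnt_def using xz(2) in_set_takeD by (intro count_notin) fast
        have "b # x @ False # z \<in> F"
          using Cons.prems(1) Cons.prems(4)[rule_format, of "[]" x z] ab by (simp add: v xz)
        \<comment> \<open>Since the first \<open>True\<close> was taken, the counts are 0 up to its
          place and one smaller afterwards, which cancels the leading \<open>True\<close> of the
          target.\<close>
        moreover have "cnt (x @ False # z) i \<le> cnt w i" for i
          using cnts[of i] ab by (cases "i - length x") (auto simp: xz cnt_append x)
        ultimately show ?thesis using IH len by (simp add: xz dominated_def)
      next
        case False
        then have z: "cnt v' i = 0" for i
          unfolding cnt_def using in_set_takeD by (intro count_notin) fast
        have "b # v' \<in> F"
          using Cons.prems(1) Cons.prems(3)[rule_format, of "[]" v'] ab by (simp add: v)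
        then show ?thesis using IH len by (simp add: z dominated_def)
      qed
    qed
  qed
qed (use assms(1) in auto)

section \<open>Compressions and shifts\<close>

text \<open>Compressions and shifts in one: \<phi> is meant to be an involution, \<open>P\<close>
  marks the preferred partner of a pair, and a set whose preferred partner is absent is replaced by
  it.\<close>

definition push :: "('a \<Rightarrow> 'a) \<Rightarrow> ('a \<Rightarrow> bool) \<Rightarrow> 'a set \<Rightarrow> 'a set" where
  "push \<phi> P F = {S. if P S then S \<in> F \<or> \<phi> S \<in> F
     else if P (\<phi> S) then S \<in> F \<and> \<phi> S \<in> F else S \<in> F}"

lemma push_bij:
  assumes inv: "\<And>S. \<phi> (\<phi> S) = S" and P: "\<And>S. P S \<Longrightarrow> \<not> P (\<phi> S)"
  shows "bij_betw (\<lambda>S. if P (\<phi> S) \<and> \<phi> S \<notin> F then \<phi> S else S) F (push \<phi> P F)"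
  unfolding bij_betw_def
proof
  let ?g = "\<lambda>S. if P (\<phi> S) \<and> \<phi> S \<notin> F then \<phi> S else S"
  show "inj_on ?g F"
  proof (rule inj_onI)
    fix S T assume "S \<in> F" "T \<in> F" "?g S = ?g T"
    then show "S = T" using inv by (auto split: if_splits) metis+
  qed
  show "?g ` F = push \<phi> P F"
  proof (intro set_eqI iffI)
    fix T assume "T \<in> ?g ` F"
    then obtain S where "S \<in> F" "T = ?g S" by blast
    then show "T \<in> push \<phi> P F" by (auto simp: push_def inv)
  next
    fix T assume T: "T \<in> push \<phi> P F"
    show "T \<in> ?g ` F"
    proof (cases "T \<in> F")
      case True
      then have "T = ?g T" using T P by (auto simp: push_def split: if_splits)
      then show ?thesis using True by blast
    next
      case False
      then have "P T" "\<phi> T \<in> F" using T by (auto simp: push_def split: if_splits)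
      then have "T = ?g (\<phi> T)" using False inv by auto
      then show ?thesis using \<open>\<phi> T \<in> F\<close> by blast
    qed
  qed
qed

lemma card_push:
  assumes "\<And>S. \<phi> (\<phi> S) = S" "\<And>S. P S \<Longrightarrow> \<not> P (\<phi> S)"
  shows "card (push \<phi> P F) = card F"
  using bij_betw_same_card[OF push_bij[of \<phi> P F]] assms by auto

text \<open>A termination measure: a push that changes F replaces some set by a lighter partner and
  none by a heavier one.\<close>

lemma sum_push_less:
  fixes w :: "'a \<Rightarrow> nat"
  assumes inv: "\<And>S. \<phi> (\<phi> S) = S" and P: "\<And>S. P S \<Longrightarrow> \<not> P (\<phi> S)"
    and "finite F" "push \<phi> P F \<noteq> F" and w: "\<And>S. S \<in> F \<Longrightarrow> P (\<phi> S) \<Longrightarrow> w (\<phi> S) < w S"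
  shows "sum w (push \<phi> P F) < sum w F"
proof -
  define g where "g S = (if P (\<phi> S) \<and> \<phi> S \<notin> F then \<phi> S else S)" for S
  have bij: "bij_betw g F (push \<phi> P F)"
    unfolding g_def using push_bij[of \<phi> P F] assms by auto
  have "\<exists>S\<in>F. w (g S) < w S"
  proof (rule ccontr)
    assume none: "\<not> ?thesis"
    have "g S = S" if "S \<in> F" for S using none w that by (auto simp: g_def)
    then have "g ` F = F" by (auto simp: image_iff)
    then show False using bij assms(4) by (simp add: bij_betw_def)
  qed
  moreover have "\<forall>S\<in>F. w (g S) \<le> w S" using w by (auto simp: g_def less_imp_le)
  ultimately have "(\<Sum>S\<in>F. w (g S)) < sum w F"
    using \<open>finite F\<close> by (intro sum_strict_mono_ex1) auto
  then show ?thesis using sum.reindex_bij_betw[OF bij, of w] by simp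
qed

definition compress :: "'a \<Rightarrow> 'a set set \<Rightarrow> 'a set set" where
  "compress x = push (\<lambda>S. if x \<in> S then S - {x} else insert x S) (\<lambda>S. x \<notin> S)"

definition swap :: "'a \<Rightarrow> 'a \<Rightarrow> 'a set \<Rightarrow> 'a set" where
  "swap i j S = (if i \<in> S \<and> j \<notin> S then insert j (S - {i})
     else if j \<in> S \<and> i \<notin> S then insert i (S - {j}) else S)"

text \<open>The direction is from \<open>j\<close> to \<open>i\<close>.\<close>

definition shift :: "'a \<Rightarrow> 'a \<Rightarrow> 'a set set \<Rightarrow> 'a set set" where
  "shift i j = push (swap i j) (\<lambda>S. i \<in> S \<and> j \<notin> S)"

lemma mem_compress:
  "S \<in> compress x F \<longleftrightarrow> (if x \<in> S then S \<in> F \<and> S - {x} \<in> F else S \<in> F \<or> insert x S \<in> F)"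
  by (auto simp: compress_def push_def)

lemma card_compress: "card (compress x F) = card F"
  unfolding compress_def by (rule card_push) (auto simp: insert_absorb)

lemma swap_swap [simp]: "i \<noteq> j \<Longrightarrow> swap i j (swap i j S) = S"
  by (auto simp: swap_def)

lemma mem_shift:
  assumes "i \<noteq> j"
  shows "S \<in> shift i j F \<longleftrightarrow> (if i \<in> S \<and> j \<notin> S then S \<in> F \<or> insert j (S - {i}) \<in> F
    else if j \<in> S \<and> i \<notin> S then S \<in> F \<and> insert i (S - {j}) \<in> F else S \<in> F)"
  using assms by (auto simp: shift_def push_def swap_def)

lemma card_shift: "i \<noteq> j \<Longrightarrow> card (shift i j F) = card F"
  unfolding shift_def by (rule card_push) (auto simp: swap_def)

section \<open>Agreement under compressions and shifts\<close>

definition agreeing :: "nat \<Rightarrow> nat \<Rightarrow> nat set \<Rightarrow> nat set set \<Rightarrow> bool" where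
  "agreeing r t V F \<longleftrightarrow>
     (\<forall>Fs. (\<forall>i<r. Fs i \<in> F) \<longrightarrow> t \<le> card {x \<in> V. agree_on r Fs x})"

lemma agreeingD:
  "agreeing r t V F \<Longrightarrow> (\<And>i. i < r \<Longrightarrow> Fs i \<in> F) \<Longrightarrow> t \<le> card {x \<in> V. agree_on r Fs x}"
  by (auto simp: agreeing_def)

lemma agree_on_cong:
  "(\<And>i. i < r \<Longrightarrow> y \<in> Fs i \<longleftrightarrow> y \<in> Gs i) \<Longrightarrow> agree_on r Fs y \<longleftrightarrow> agree_on r Gs y"
  by (auto simp: agree_on_def)

text \<open>It suffices to find members \<open>Fs\<close> of F that equal \<open>Gs\<close> off x
  and do not agree at x unless \<open>Gs\<close> do. If \<open>Gs\<close> disagree at x, one of them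
  contains x; it survived the compression, so F has it with and without x, and one version differs
  at x from the set chosen for \<open>i1\<close>.\<close>

lemma agreeing_compress:
  assumes "finite V" "agreeing r t V F"
  shows "agreeing r t V (compress x F)"
  unfolding agreeing_def
proof (intro allI impI)
  fix Gs assume G: "\<forall>i<r. Gs i \<in> compress x F"
  have "\<exists>S. S \<in> F \<and> S - {x} = Gs i - {x}" if "i < r" for i
    using G[rule_format, OF that] by (auto simp: mem_compress split: if_splits)
  then obtain e where e: "\<And>i. i < r \<Longrightarrow> e i \<in> F" "\<And>i. i < r \<Longrightarrow> e i - {x} = Gs i - {x}"
    by metis
  obtain Fs where Fs: "\<And>i. i < r \<Longrightarrow> Fs i \<in> F" "\<And>i. i < r \<Longrightarrow> Fs i - {x} = Gs i - {x}"
    "agree_on r Fs x \<Longrightarrow> agree_on r Gs x"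
  proof (cases "agree_on r Gs x")
    case True
    then show ?thesis using that[of e] e by blast
  next
    case False
    then obtain i0 i1 where i: "i0 < r" "x \<in> Gs i0" "i1 < r" "x \<notin> Gs i1"
      by (auto simp: agree_on_def)
    define Fs where "Fs = e(i0 := if x \<in> e i1 then Gs i0 - {x} else Gs i0)"
    have "i0 \<noteq> i1" using i by auto
    then have "x \<in> Fs i0 \<longleftrightarrow> x \<notin> Fs i1" using i by (auto simp: Fs_def)
    then have "\<not> agree_on r Fs x" using i by (auto simp: agree_on_def)
    moreover have "Gs i0 \<in> F" "Gs i0 - {x} \<in> F"
      using G i by (auto simp: mem_compress split: if_splits)
    then have "\<And>i. i < r \<Longrightarrow> Fs i \<in> F" "\<And>i. i < r \<Longrightarrow> Fs i - {x} = Gs i - {x}"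
      using e by (auto simp: Fs_def)
    ultimately show ?thesis using that by blast
  qed
  have "t \<le> card {y \<in> V. agree_on r Fs y}" by (rule agreeingD[OF assms(2) Fs(1)])
  also have "\<dots> \<le> card {y \<in> V. agree_on r Gs y}"
  proof (intro card_mono subsetI)
    fix y assume y: "y \<in> {y \<in> V. agree_on r Fs y}"
    show "y \<in> {y \<in> V. agree_on r Gs y}"
    proof (cases "y = x")
      case True
      then show ?thesis using y Fs(3) by simp
    next
      case False
      then have "y \<in> Fs i \<longleftrightarrow> y \<in> Gs i" if "i < r" for i using Fs(2)[OF that] by blast
      then show ?thesis using y agree_on_cong[of r y Fs Gs] by simp
    qed
  qed (use assms in auto)
  finally show "t \<le> card {y \<in> V. agree_on r Gs y}" .
qed

definition downset :: "'a set set \<Rightarrow> bool" where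
  "downset F \<longleftrightarrow> (\<forall>S\<in>F. \<forall>T\<subseteq>S. T \<in> F)"

definition union_bounded :: "nat \<Rightarrow> nat \<Rightarrow> 'a set \<Rightarrow> 'a set set \<Rightarrow> bool" where
  "union_bounded r t V F \<longleftrightarrow>
     (\<forall>Fs. (\<forall>i<r. Fs i \<in> F) \<longrightarrow> t \<le> card (V - (\<Union>i<r. Fs i)))"

lemma union_boundedD:
  "union_bounded r t V F \<Longrightarrow> (\<And>i. i < r \<Longrightarrow> Fs i \<in> F) \<Longrightarrow> t \<le> card (V - (\<Union>i<r. Fs i))"
  by (auto simp: union_bounded_def)

text \<open>Replacing the first set by \<open>Fs 0 - Fs 1\<close> stays inside a downset, keeps the
  union, and leaves no point common to all sets. Every agreement is then a point outside the
  union.\<close>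

lemma union_bounded_of_agreeing:
  assumes "2 \<le> r" "finite V" "downset F" "agreeing r t V F"
  shows "union_bounded r t V F"
  unfolding union_bounded_def
proof (intro allI impI)
  fix Fs assume F: "\<forall>i<r. Fs i \<in> F"
  define Gs where "Gs = Fs(0 := Fs 0 - Fs 1)"
  have "\<And>i. i < r \<Longrightarrow> Gs i \<in> F"
    using F assms(1,3) unfolding downset_def Gs_def
    by (metis Diff_subset fun_upd_other fun_upd_same)
  then have "t \<le> card {x \<in> V. agree_on r Gs x}" by (rule agreeingD[OF assms(4)])
  also have "\<dots> \<le> card (V - (\<Union>i<r. Fs i))"
  proof (intro card_mono subsetI)
    fix x assume "x \<in> {x \<in> V. agree_on r Gs x}"
    then have x: "x \<in> V" "agree_on r Gs x" by auto
    have "\<not> (x \<in> Gs 0 \<and> x \<in> Gs 1)" by (auto simp: Gs_def)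
    then have "\<forall>i<r. x \<notin> Gs i" using x(2) assms(1) by (auto simp: agree_on_def)
    then have G: "x \<notin> Gs i" if "i < r" for i using that by blast
    have "x \<notin> Fs i" if "i < r" for i
      using G[of i] G[of 0] G[of 1] that assms(1) by (cases "i = 0") (auto simp: Gs_def)
    then show "x \<in> V - (\<Union>i<r. Fs i)" using x by auto
  qed (use assms in auto)
  finally show "t \<le> card (V - (\<Union>i<r. Fs i))" .
qed

lemma downset_of_compress:
  assumes "finite V" "F \<subseteq> Pow V" "\<And>x. x \<in> V \<Longrightarrow> compress x F = F"
  shows "downset F"
proof -
  have del: "S - {x} \<in> F" if "S \<in> F" for S x
  proof (cases "x \<in> S")
    case True
    then have "compress x F = F" using assms(2,3) that by blast
    then show ?thesis using that True mem_compress[of S x F] by simp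
  qed (use that in simp)
  have "S - X \<in> F" if "S \<in> F" "finite X" for S X
    using that(2)
  proof induction
    case (insert x X)
    have "S - insert x X = S - X - {x}" by auto
    then show ?case using del insert by simp
  qed (use that in simp)
  moreover have "T = S - (S - T)" if "T \<subseteq> S" for T S :: "'a set" using that by auto
  ultimately show ?thesis
    unfolding downset_def using assms(1,2) by (metis PowD finite_Diff finite_subset subsetD)
qed

lemma downset_shift:
  assumes "i \<noteq> j" "downset F"
  shows "downset (shift i j F)"
  unfolding downset_def
proof (intro ballI allI impI)
  fix S T assume S: "S \<in> shift i j F" and T: "T \<subseteq> S"
  have d: "A \<in> F \<Longrightarrow> B \<subseteq> A \<Longrightarrow> B \<in> F" for A B using assms(2) by (auto simp: downset_def)
  consider "i \<in> S" "j \<notin> S" | "j \<in> S" "i \<notin> S" | "i \<in> S" "j \<in> S" | "i \<notin> S" "j \<notin> S" by blast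
  then show "T \<in> shift i j F"
  proof cases
    case 1
    then have j: "j \<notin> T" using T by auto
    have "S \<in> F \<or> insert j (S - {i}) \<in> F" using 1 S by (simp add: mem_shift assms(1))
    then show ?thesis
    proof
      assume "S \<in> F"
      then have "T \<in> F" using T by (rule d)
      then show ?thesis using j by (simp add: mem_shift assms(1))
    next
      assume X: "insert j (S - {i}) \<in> F"
      have "insert j (T - {i}) \<in> F" by (rule d[OF X]) (use T in auto)
      moreover have "T \<in> F" if "i \<notin> T" by (rule d[OF X]) (use T that in auto)
      ultimately show ?thesis using j by (simp add: mem_shift assms(1))
    qed
  next
    case 2
    then have i: "i \<notin> T" using T by auto
    have "S \<in> F" "insert i (S - {j}) \<in> F" using 2 S by (simp_all add: mem_shift assms(1))
    then have "T \<in> F" "insert i (T - {j}) \<in> F" using T by (auto intro: d)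
    then show ?thesis using i by (simp add: mem_shift assms(1))
  next
    case 3
    then have "S \<in> F" using S by (simp add: mem_shift assms(1))
    then have "T \<in> F" "insert i (T - {j}) \<in> F" using T 3 by (auto intro: d)
    then show ?thesis by (simp add: mem_shift assms(1))
  next
    case 4
    then have "S \<in> F" using S by (simp add: mem_shift assms(1))
    then have "T \<in> F" using T by (rule d)
    moreover have "i \<notin> T" "j \<notin> T" using T 4 by auto
    ultimately show ?thesis by (simp add: mem_shift assms(1))
  qed
qed

text \<open>Shifted sets come from members of F that equal them outside i and j, so only the
  covering of {i, j} matters. Some \<open>Gs k\<close> outside F contains i, and its origin contains
  j. If no \<open>Gs\<close> contains j, then \<open>Gs\<close> miss j while the origins miss at
  most i. If \<open>Gs l\<close> contains j, it may be exchanged for a member containing i, and both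
  points are covered.\<close>

lemma union_bounded_shift:
  assumes ij: "i \<noteq> j" "i \<in> V" "j \<in> V" and "finite V" "union_bounded r t V F"
  shows "union_bounded r t V (shift i j F)"
  unfolding union_bounded_def
proof (intro allI impI)
  fix Gs assume G: "\<forall>k<r. Gs k \<in> shift i j F"
  have key: "t \<le> card (V - (\<Union>k<r. Gs k))"
    if F: "\<And>k. k < r \<Longrightarrow> Fs k \<in> F" and same: "\<And>k. k < r \<Longrightarrow> Fs k - {i, j} = Gs k - {i, j}"
      and c: "card ({i, j} - (\<Union>k<r. Fs k)) \<le> card ({i, j} - (\<Union>k<r. Gs k))" for Fs
  proof -
    have split: "card (V - U) = card (V - U - {i, j}) + card ({i, j} - U)" for U
    proof -
      have "V - U = (V - U - {i, j}) \<union> ({i, j} - U)" using ij by auto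
      moreover have "(V - U - {i, j}) \<inter> ({i, j} - U) = {}" by auto
      ultimately show ?thesis using \<open>finite V\<close> card_Un_disjoint[of "V - U - {i, j}" "{i, j} - U"]
        by simp
    qed
    have "V - (\<Union>k<r. Fs k) - {i, j} = V - (\<Union>k<r. Gs k) - {i, j}"
      using same by (auto simp: set_eq_iff)
    moreover have "t \<le> card (V - (\<Union>k<r. Fs k))" by (rule union_boundedD[OF assms(5)]) (rule F)
    ultimately show ?thesis
      using split[of "\<Union>k<r. Fs k"] split[of "\<Union>k<r. Gs k"] c by simp
  qed
  show "t \<le> card (V - (\<Union>k<r. Gs k))"
  proof (cases "\<forall>k<r. Gs k \<in> F")
    case True
    then show ?thesis by (intro key[of Gs]) auto
  next
    case False
    define Fs where "Fs k = (if Gs k \<in> F then Gs k else insert j (Gs k - {i}))" for k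
    have Gi: "i \<in> Gs k \<and> j \<notin> Gs k \<and> insert j (Gs k - {i}) \<in> F" if "k < r" "Gs k \<notin> F" for k
      using G that by (auto simp: mem_shift ij split: if_splits)
    then have F: "Fs k \<in> F" "Fs k - {i, j} = Gs k - {i, j}" if "k < r" for k
      using that by (auto simp: Fs_def)
    obtain k where k: "k < r" "Gs k \<notin> F" using False by blast
    then have kF: "j \<in> Fs k" "i \<in> Gs k" using Gi by (auto simp: Fs_def)
    show ?thesis
    proof (cases "\<exists>l<r. j \<in> Gs l")
      case True
      then obtain l where l: "l < r" "j \<in> Gs l" by blast
      then have lF: "Gs l \<in> F" using Gi by blast
      define Hs where "Hs = Fs(l := if i \<in> Gs l then Gs l else insert i (Gs l - {j}))"
      have kl: "k \<noteq> l" using k lF by auto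
      have "Hs l \<in> F"
        using G l lF by (auto simp: mem_shift ij Hs_def insert_absorb split: if_splits)
      moreover have "Hs l - {i, j} = Gs l - {i, j}" by (auto simp: Hs_def)
      ultimately have "\<And>k. k < r \<Longrightarrow> Hs k \<in> F" "\<And>k. k < r \<Longrightarrow> Hs k - {i, j} = Gs k - {i, j}"
        using F by (auto simp: Hs_def)
      moreover have "i \<in> (\<Union>k<r. Hs k)" using l by (auto simp: Hs_def)
      moreover have "j \<in> (\<Union>k<r. Hs k)" using k kF kl by (auto simp: Hs_def intro!: bexI[of _ k])
      then have "{i, j} - (\<Union>k<r. Hs k) = {}" using \<open>i \<in> (\<Union>k<r. Hs k)\<close> by blast
      ultimately show ?thesis by (intro key[of Hs]) auto
    next
      case False
      then have "{i, j} - (\<Union>k<r. Gs k) = {j}" using kF k by auto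
      moreover have "{i, j} - (\<Union>k<r. Fs k) \<subseteq> {i}" using kF k by auto
      then have "card ({i, j} - (\<Union>k<r. Fs k)) \<le> card {i}" by (rule card_mono[rotated]) simp
      ultimately show ?thesis using F by (intro key[of Fs]) auto
    qed
  qed
qed

section \<open>Extremal families and their preimages\<close>

definition symdiff :: "'a set \<Rightarrow> 'a set \<Rightarrow> 'a set" where
  "symdiff S R = (S - R) \<union> (R - S)"

lemma mem_symdiff [simp]: "x \<in> symdiff S R \<longleftrightarrow> (x \<in> S) \<noteq> (x \<in> R)"
  by (auto simp: symdiff_def)

lemma symdiff_symdiff [simp]: "symdiff (symdiff S R) R = S"
  by auto

lemma symdiff_empty [simp]: "symdiff S {} = S"
  by auto

lemma symdiff_subset_iff: "R \<subseteq> V \<Longrightarrow> symdiff S R \<subseteq> V \<longleftrightarrow> S \<subseteq> V"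
  by (auto simp: subset_iff)

text \<open>For R inside A and A inside V this is the extremal family, written as a condition on the
  translated set.\<close>

definition star :: "'a set \<Rightarrow> 'a set \<Rightarrow> 'a set \<Rightarrow> 'a set set" where
  "star V A R = {S. S \<subseteq> V \<and> card (symdiff S R \<inter> A) \<le> 1}"

lemma obtain_injection:
  assumes "finite B" "r \<le> card B" "2 \<le> r" "y \<in> B" "z \<in> B" "y \<noteq> z"
  obtains f :: "nat \<Rightarrow> 'a" where "inj_on f {..<r}" "f ` {..<r} \<subseteq> B" "f 0 = y" "f 1 = z"
proof -
  have "r - 2 \<le> card (B - {y, z})"
    using assms by (simp add: card_Diff_subset)
  then obtain T where T: "T \<subseteq> B - {y, z}" "card T = r - 2"
    by (meson obtain_subset_with_card_n)
  then have "finite T" using assms(1) finite_subset by blast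
  then obtain g where g: "bij_betw g {0..<r - 2} T"
    using T(2) ex_bij_betw_nat_finite by metis
  define f where "f i = (if i = 0 then y else if i = 1 then z else g (i - 2))" for i
  have gT: "g (i - 2) \<in> T" if "2 \<le> i" "i < r" for i
    using bij_betwE[OF g] that by auto
  have inj: "g (i - 2) = g (j - 2) \<Longrightarrow> i = j" if "2 \<le> i" "i < r" "2 \<le> j" "j < r" for i j
  proof -
    assume "g (i - 2) = g (j - 2)"
    then have "i - 2 = j - 2"
      by (rule inj_onD[OF bij_betw_imp_inj_on[OF g]]) (use that in auto)
    then show "i = j" using that by linarith
  qed
  have f2: "f i = g (i - 2)" "f i \<notin> {y, z}" "f i \<in> B" if "2 \<le> i" "i < r" for i
    using that gT[OF that] T by (auto simp: f_def)
  have "inj_on f {..<r}"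
  proof (rule inj_onI)
    fix i j assume ij: "i \<in> {..<r}" "j \<in> {..<r}" "f i = f j"
    consider "2 \<le> i" "2 \<le> j" | "2 \<le> i" "j < 2" | "i < 2" "2 \<le> j" | "i < 2" "j < 2" by linarith
    then show "i = j"
    proof cases
      case 1
      then show ?thesis using ij f2(1)[of i] f2(1)[of j] inj[of i j] by simp
    next
      case 2
      then show ?thesis using ij f2(2)[of i] by (auto simp: f_def[of j] split: if_splits)
    next
      case 3
      then show ?thesis using ij f2(2)[of j] by (auto simp: f_def[of i] split: if_splits)
    next
      case 4
      then show ?thesis using ij assms(6) by (auto simp: f_def less_2_cases_iff)
    qed
  qed
  moreover have "f i \<in> B" if "i < r" for i
    using f2(3)[of i] that assms(4,5) by (cases "2 \<le> i") (auto simp: f_def)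
  then have "f ` {..<r} \<subseteq> B" by auto
  ultimately show ?thesis using that by (simp add: f_def)
qed

text \<open>Sets that meet \<open>B\<close> in distinct single points jointly miss only
  \<open>card B - r\<close> points; this makes mixed fibres impossible in both lemmas below.\<close>

lemma card_avoid_image:
  assumes "finite B" "inj_on f {..<r}" "f ` {..<r} \<subseteq> B" "X \<subseteq> B - f ` {..<r}"
  shows "card X \<le> card B - r"
proof -
  have "card X \<le> card (B - f ` {..<r})" using assms by (intro card_mono) auto
  also have "\<dots> = card B - r"
    using assms by (subst card_Diff_subset) (auto simp: card_image)
  finally show ?thesis .
qed

text \<open>For x outside A the star does not see x, so nothing was moved. For x in A and B = A -
  {x}, the pair S, \<open>insert x S\<close> has both, one or no member in F when S meets B in 0, 1
  or more points. The pairs with one member all choose alike, giving the centre {} or {x}: by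
  \<open>conflict\<close>, different choices would produce r sets agreeing in at most card B - r = t
  - 1 points.\<close>

lemma compress_back_origin:
  assumes r: "3 \<le> r" and t: "1 \<le> t" and V: "finite V" "F \<subseteq> Pow V"
    and ag: "agreeing r t V F" and A: "A \<subseteq> V" "card A = r + t"
    and C: "compress x F = star V A {}"
  shows "\<exists>R\<subseteq>A. F = star V A R"
proof -
  have C': "S \<in> compress x F \<longleftrightarrow> S \<subseteq> V \<and> card (S \<inter> A) \<le> 1" for S
    unfolding C star_def by simp
  have finA: "finite A" using A V finite_subset by blast
  show ?thesis
  proof (cases "x \<in> A")
    case False
    have "S \<in> F \<longleftrightarrow> S \<in> compress x F" for S
    proof -
      have del: "(S - {x}) \<inter> A = S \<inter> A" and ins: "insert x S \<inter> A = S \<inter> A"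
        using False by auto
      show ?thesis
      proof
        assume S: "S \<in> F"
        then have "S - {x} \<in> compress x F"
          by (cases "x \<in> S") (simp_all add: mem_compress insert_absorb)
        then show "S \<in> compress x F" using S V(2) by (auto simp: C' del)
      next
        assume S: "S \<in> compress x F"
        show "S \<in> F"
        proof (cases "S \<in> F \<or> x \<in> S")
          case True
          then show ?thesis using S by (auto simp: mem_compress)
        next
          case False
          then have X: "insert x S \<in> F" using S by (simp add: mem_compress)
          then have "insert x S \<in> compress x F" using S V(2) by (auto simp: C' ins)
          then show ?thesis using False by (simp add: mem_compress)
        qed
      qed
    qed
    then have "F = star V A {}" using C by blast
    then show ?thesis by blast
  next
    case x: True
    define B where "B = A - {x}"
    have xV: "x \<in> V" using x A by auto
    have B: "finite B" "card B = r + t - 1" "x \<notin> B" "B \<subseteq> V" "A = insert x B"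
      using finA A x by (auto simp: B_def)
    have cA: "card (S \<inter> A) = card (S \<inter> B)" "card (insert x S \<inter> A) = Suc (card (S \<inter> B))"
      if "x \<notin> S" for S
      using that B(1,3) by (simp_all add: B(5))
    have none: "S \<in> F \<and> insert x S \<in> F" if "S \<subseteq> V" "x \<notin> S" "card (S \<inter> B) = 0" for S
      using C'[of "insert x S"] cA[OF that(2)] that xV by (auto simp: mem_compress)
    have one: "S \<in> F \<longleftrightarrow> insert x S \<notin> F" if "S \<subseteq> V" "x \<notin> S" "card (S \<inter> B) = 1" for S
      using C'[of S] C'[of "insert x S"] cA[OF that(2)] that xV by (auto simp: mem_compress)
    have many: "S \<notin> F \<and> insert x S \<notin> F" if "S \<subseteq> V" "x \<notin> S" "2 \<le> card (S \<inter> B)" for S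
      using C'[of S] cA[OF that(2)] that by (auto simp: mem_compress)
    have conflict: "y = z"
      if S: "S \<subseteq> V" "x \<notin> S" "S \<inter> B = {y}" "insert x S \<in> F"
        and T: "T \<subseteq> V" "x \<notin> T" "T \<inter> B = {z}" "T \<in> F" for S T y z
    proof (rule ccontr)
      assume yz: "y \<noteq> z"
      have yzB: "y \<in> B" "z \<in> B" using S T by auto
      have rB: "r \<le> card B" "2 \<le> r" using B(2) r t by auto
      obtain f where f: "inj_on f {..<r}" "f ` {..<r} \<subseteq> B" "f 0 = y" "f 1 = z"
        using obtain_injection[OF B(1) rB yzB yz] by blast
      have fB: "f i \<in> B" if "i < r" for i using f(2) that by auto
      \<comment> \<open>Set 0 will differ from set 1 at x and from set 2 at every point outside A;
        on B the traces are r distinct single points.\<close>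
      define Ts where "Ts i = (if i = 0 then S else if i = 1 then T
        else if i = 2 then insert (f 2) (V - A - S) else {f i})" for i :: nat
      have Ts: "Ts i \<subseteq> V" "x \<notin> Ts i" "Ts i \<inter> B = {f i}" if "i < r" for i
        using fB[OF that] S T f B by (auto simp: Ts_def)
      define Fs where "Fs i = (if i = 0 then insert x S else if Ts i \<in> F then Ts i else insert x (Ts i))"
        for i
      have Fs: "Fs i \<in> F" if "i < r" for i
        using one[OF Ts(1,2)[OF that]] Ts(3)[OF that] S(4) by (auto simp: Fs_def)
      have FT: "y \<in> Fs i \<longleftrightarrow> y \<in> Ts i" if "y \<noteq> x" for y i
        using that by (auto simp: Fs_def Ts_def)
      have F1: "Fs 1 = T" using T(4) by (simp add: Fs_def Ts_def)
      have "{y \<in> V. agree_on r Fs y} \<subseteq> B - f ` {..<r}"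
      proof
        fix u assume "u \<in> {y \<in> V. agree_on r Fs y}"
        then have u: "u \<in> V" and ag: "agree_on r Fs u" by auto
        have same: "u \<in> Fs i \<longleftrightarrow> u \<in> Fs j" if "i < r" "j < r" for i j
          using ag that by (auto simp: agree_on_def)
        have "u \<noteq> x"
        proof
          assume "u = x"
          moreover have "x \<in> Fs 0" by (simp add: Fs_def)
          moreover have "x \<notin> Fs 1" unfolding F1 by (rule T(2))
          ultimately show False using same[of 0 1] r by simp
        qed
        then have sameT: "u \<in> Ts i \<longleftrightarrow> u \<in> Ts j" if "i < r" "j < r" for i j
          using same[OF that] FT by simp
        have "u \<in> B"
        proof (rule ccontr)
          assume "u \<notin> B"
          then have "u \<in> V - A" "u \<noteq> f 2" using u \<open>u \<noteq> x\<close> B(5) fB[of 2] r by auto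
          then show False using sameT[of 0 2] r by (auto simp: Ts_def)
        qed
        moreover have "u \<noteq> f i" if i: "i < r" for i
        proof
          assume ui: "u = f i"
          define j where "j = (if i = 0 then 1 else 0 :: nat)"
          have j: "j < r" "j \<noteq> i" using r by (auto simp: j_def)
          have "f i \<noteq> f j" using inj_onD[OF f(1), of i j] i j by auto
          moreover have "f i \<in> Ts i" using Ts(3)[OF i] by auto
          then have "f i \<in> Ts j \<inter> B" using sameT[OF i j(1)] ui fB[OF i] by simp
          ultimately show False using Ts(3)[OF j(1)] by auto
        qed
        ultimately show "u \<in> B - f ` {..<r}" by auto
      qed
      from card_avoid_image[OF B(1) f(1,2) this]
      have "card {y \<in> V. agree_on r Fs y} < t" using B(2) t by simp
      moreover have "t \<le> card {y \<in> V. agree_on r Fs y}" by (rule agreeingD[OF ag Fs])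
      ultimately show False by simp
    qed
    have cases: "(\<forall>S. S \<subseteq> V \<longrightarrow> x \<notin> S \<longrightarrow> card (S \<inter> B) = 1 \<longrightarrow> S \<in> F) \<or>
        (\<forall>S. S \<subseteq> V \<longrightarrow> x \<notin> S \<longrightarrow> card (S \<inter> B) = 1 \<longrightarrow> insert x S \<in> F)"
    proof (rule ccontr)
      assume "\<not> ?thesis"
      then obtain S T where S: "S \<subseteq> V" "x \<notin> S" "card (S \<inter> B) = 1" "S \<notin> F"
        and T: "T \<subseteq> V" "x \<notin> T" "card (T \<inter> B) = 1" "insert x T \<notin> F" by blast
      obtain y z where yz: "S \<inter> B = {y}" "T \<inter> B = {z}"
        using S(3) T(3) by (meson card_1_singletonE)
      have S': "insert x S \<in> F" and T': "T \<in> F" using one S T by blast+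
      \<comment> \<open>The opposite choices may share their trace. A pair with another trace u then
        conflicts with whichever of the two chose differently.\<close>
      have "y = z" by (rule conflict[OF S(1,2) yz(1) S' T(1,2) yz(2) T'])
      have "card {y} < card B" using B(2) r t by simp
      then have "\<not> B \<subseteq> {y}" using card_mono[of "{y}" B] by auto
      then obtain u where u: "u \<in> B" "u \<noteq> y" by blast
      have U: "{u} \<subseteq> V" "x \<notin> {u}" "{u} \<inter> B = {u}" using u B by auto
      then have "{u} \<in> F \<or> insert x {u} \<in> F" using one[OF U(1,2)] by auto
      then show False
      proof
        assume "{u} \<in> F"
        from conflict[OF S(1,2) yz(1) S' U this] u show False by simp
      next
        assume "insert x {u} \<in> F"
        from conflict[OF U this T(1,2) yz(2) T'] u \<open>y = z\<close> show False by simp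
      qed
    qed
    have FV: "S \<in> F \<Longrightarrow> S \<subseteq> V" for S using V by blast
    have eq0: "S \<in> star V A {} \<longleftrightarrow> S \<subseteq> V \<and> (if x \<in> S then card ((S - {x}) \<inter> B) = 0 else card (S \<inter> B) \<le> 1)" for S
      using cA(1)[of S] cA(2)[of "S - {x}"] by (auto simp: star_def insert_absorb)
    have eq1: "S \<in> star V A {x} \<longleftrightarrow> S \<subseteq> V \<and> (if x \<in> S then card ((S - {x}) \<inter> B) \<le> 1 else card (S \<inter> B) = 0)" for S
    proof (cases "x \<in> S")
      case True
      then have "symdiff S {x} = S - {x}" by auto
      then show ?thesis using True cA(1)[of "S - {x}"] by (auto simp: star_def)
    next
      case False
      then have "symdiff S {x} = insert x S" by auto
      then show ?thesis using False cA(2)[of S] by (auto simp: star_def)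
    qed
    have tri: "c = 0 \<or> c = 1 \<or> 2 \<le> c" for c :: nat by linarith
    from cases show ?thesis
    proof
      assume all: "\<forall>S. S \<subseteq> V \<longrightarrow> x \<notin> S \<longrightarrow> card (S \<inter> B) = 1 \<longrightarrow> S \<in> F"
      have D: "(insert x D \<in> F \<longleftrightarrow> card (D \<inter> B) = 0) \<and> (D \<in> F \<longleftrightarrow> card (D \<inter> B) \<le> 1)"
        if D: "D \<subseteq> V" "x \<notin> D" for D
        using tri[of "card (D \<inter> B)"]
      proof (elim disjE)
        assume c: "card (D \<inter> B) = 0"
        show ?thesis using none[OF D c] c by simp
      next
        assume c: "card (D \<inter> B) = 1"
        show ?thesis using one[OF D c] all[rule_format, OF D c] c by simp
      next
        assume c: "2 \<le> card (D \<inter> B)"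
        show ?thesis using many[OF D c] c by simp
      qed
      have "S \<in> F \<longleftrightarrow> S \<in> star V A {}" if "S \<subseteq> V" for S
      proof (cases "x \<in> S")
        case True
        have "S - {x} \<subseteq> V" "x \<notin> S - {x}" "insert x (S - {x}) = S" using that True by auto
        then show ?thesis using D[of "S - {x}"] True that unfolding eq0 by simp
      next
        case False
        then show ?thesis using D[of S] that unfolding eq0 by simp
      qed
      then have "F = star V A {}" using FV unfolding star_def by blast
      then show ?thesis by blast
    next
      assume all: "\<forall>S. S \<subseteq> V \<longrightarrow> x \<notin> S \<longrightarrow> card (S \<inter> B) = 1 \<longrightarrow> insert x S \<in> F"
      have D: "(insert x D \<in> F \<longleftrightarrow> card (D \<inter> B) \<le> 1) \<and> (D \<in> F \<longleftrightarrow> card (D \<inter> B) = 0)"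
        if D: "D \<subseteq> V" "x \<notin> D" for D
        using tri[of "card (D \<inter> B)"]
      proof (elim disjE)
        assume c: "card (D \<inter> B) = 0"
        show ?thesis using none[OF D c] c by simp
      next
        assume c: "card (D \<inter> B) = 1"
        show ?thesis using one[OF D c] all[rule_format, OF D c] c by simp
      next
        assume c: "2 \<le> card (D \<inter> B)"
        show ?thesis using many[OF D c] c by simp
      qed
      have "S \<in> F \<longleftrightarrow> S \<in> star V A {x}" if "S \<subseteq> V" for S
      proof (cases "x \<in> S")
        case True
        have "S - {x} \<subseteq> V" "x \<notin> S - {x}" "insert x (S - {x}) = S" using that True by auto
        then show ?thesis using D[of "S - {x}"] True that unfolding eq1 by simp
      next
        case False
        then show ?thesis using D[of S] that unfolding eq1 by simp
      qed
      then have "F = star V A {x}" using FV unfolding star_def by blast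
      then show ?thesis using x by blast
    qed
  qed
qed

definition translate :: "'a set \<Rightarrow> 'a set set \<Rightarrow> 'a set set" where
  "translate R F = {S. symdiff S R \<in> F}"

text \<open>Translation by R preserves agreement and commutes with compression at a point outside R,
  which reduces to the centre {}. The case of x in R cannot occur: compressed families are closed
  under deleting x, but deleting it from the translate of {a} makes the trace {a, x}.\<close>

lemma compress_back:
  assumes r: "3 \<le> r" and t: "1 \<le> t" and V: "finite V" "F \<subseteq> Pow V"
    and ag: "agreeing r t V F" and A: "A \<subseteq> V" "card A = r + t" and R: "R \<subseteq> A"
    and C: "compress x F = star V A R"
  shows "\<exists>R\<subseteq>A. F = star V A R"
proof -
  have "x \<notin> R"
  proof
    assume xR: "x \<in> R"
    have "card {x} < card A" using A(2) r by simp
    then have "\<not> A \<subseteq> {x}" using card_mono[of "{x}" A] by auto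
    then obtain a where a: "a \<in> A" "a \<noteq> x" by blast
    define S where "S = symdiff {a} R"
    have "symdiff S R \<inter> A = {a}" using a by (auto simp: S_def)
    then have "S \<in> compress x F"
      using a A R by (auto simp: C star_def S_def symdiff_subset_iff)
    moreover have "x \<in> S" using a xR by (simp add: S_def)
    ultimately have "S - {x} \<in> compress x F" by (simp add: mem_compress)
    then have "card (symdiff (S - {x}) R \<inter> A) \<le> 1" by (simp add: C star_def)
    moreover have "symdiff (S - {x}) R \<inter> A = {a, x}" using a xR R by (auto simp: S_def)
    ultimately show False using a by simp
  qed
  then have del: "symdiff (S - {x}) R = symdiff S R - {x}"
    and ins: "symdiff (insert x S) R = insert x (symdiff S R)"
    and mem: "x \<in> symdiff S R \<longleftrightarrow> x \<in> S" for S
    by auto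
  have RV: "R \<subseteq> V" using R A by auto
  have star: "translate R (star V A Q) = star V A (symdiff Q R)" for Q
  proof -
    have "symdiff (symdiff S R) Q = symdiff S (symdiff Q R)" for S by auto
    then show ?thesis using RV by (simp add: translate_def star_def symdiff_subset_iff)
  qed
  have "\<exists>Q\<subseteq>A. translate R F = star V A Q"
  proof (rule compress_back_origin[OF r t V(1)])
    show "translate R F \<subseteq> Pow V"
    proof
      fix S assume "S \<in> translate R F"
      then have "symdiff S R \<in> Pow V" unfolding translate_def using V(2) by blast
      then show "S \<in> Pow V" by (simp add: symdiff_subset_iff[OF RV])
    qed
    have "compress x (translate R F) = translate R (compress x F)"
      by (intro set_eqI) (simp add: mem_compress translate_def del ins mem del: mem_symdiff)
    moreover have "symdiff R R = {}" by auto
    ultimately show "compress x (translate R F) = star V A {}" by (simp add: C star)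
    show "agreeing r t V (translate R F)"
      unfolding agreeing_def
    proof (intro allI impI)
      fix Fs assume "\<forall>i<r. Fs i \<in> translate R F"
      then have "t \<le> card {y \<in> V. agree_on r (\<lambda>i. symdiff (Fs i) R) y}"
        by (intro agreeingD[OF ag]) (auto simp: translate_def)
      also have "{y \<in> V. agree_on r (\<lambda>i. symdiff (Fs i) R) y} = {y \<in> V. agree_on r Fs y}"
        by (auto simp: agree_on_def)
      finally show "t \<le> card {y \<in> V. agree_on r Fs y}" .
    qed
  qed (use A in auto)
  then obtain Q where Q: "Q \<subseteq> A" "translate R F = star V A Q" by blast
  have "F = translate R (translate R F)" by (auto simp: translate_def)
  then have "F = star V A (symdiff Q R)" using Q(2) star by simp
  moreover have "symdiff Q R \<subseteq> A" using Q(1) R by auto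
  ultimately show ?thesis by blast
qed

text \<open>If A contains i but not j, then {j, a} in the shifted family forces {i, a} into it,
  which meets A twice. If A treats i and j alike, the star is invariant under the swap and nothing
  moved. If A contains only j, the pairs \<open>insert i D\<close>, \<open>insert j D\<close> behave
  as under compression; their uniform choice gives the star over A, or over A with j replaced by
  i.\<close>

lemma shift_back:
  assumes r: "3 \<le> r" and t: "1 \<le> t" and V: "finite V" "F \<subseteq> Pow V"
    and ub: "union_bounded r t V F" and A: "A \<subseteq> V" "card A = r + t"
    and ij: "i \<noteq> j" "i \<in> V" "j \<in> V"
    and C: "shift i j F = star V A {}"
  shows "\<exists>A\<subseteq>V. card A = r + t \<and> F = star V A {}"
proof -
  have C': "S \<in> shift i j F \<longleftrightarrow> S \<subseteq> V \<and> card (S \<inter> A) \<le> 1" for S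
    unfolding C star_def by simp
  note ms = mem_shift[OF ij(1)]
  have finA: "finite A" using A V finite_subset by blast
  have FV: "S \<in> F \<Longrightarrow> S \<subseteq> V" for S using V by blast
  consider "i \<in> A" "j \<notin> A" | "i \<in> A \<longleftrightarrow> j \<in> A" | "i \<notin> A" "j \<in> A" by blast
  then show ?thesis
  proof cases
    case 1
    have "card {i} < card A" using A(2) r by simp
    then have "\<not> A \<subseteq> {i}" using card_mono[of "{i}" A] by auto
    then obtain a where a: "a \<in> A" "a \<noteq> i" by blast
    have "{j, a} \<inter> A = {a}" using a 1 by auto
    then have "{j, a} \<in> shift i j F" using C'[of "{j, a}"] ij a A by auto
    moreover have "insert i ({j, a} - {j}) = {i, a}" using a 1 by auto
    ultimately have "{i, a} \<in> F" using a ij by (simp add: ms)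
    then have "{i, a} \<in> shift i j F" using a ij 1 by (auto simp: ms)
    moreover have "{i, a} \<inter> A = {i, a}" using a 1 by auto
    ultimately show ?thesis using C'[of "{i, a}"] a by simp
  next
    case 2
    have sw: "swap i j S \<in> shift i j F \<longleftrightarrow> S \<in> shift i j F" for S
    proof -
      have "bij_betw (\<lambda>x. if x = i then j else if x = j then i else x) (S \<inter> A) (swap i j S \<inter> A)"
        using 2 ij
        by (intro bij_betw_byWitness[where f' = "\<lambda>x. if x = i then j else if x = j then i else x"])
          (auto simp: swap_def)
      then have "card (S \<inter> A) = card (swap i j S \<inter> A)" by (rule bij_betw_same_card)
      moreover have "swap i j S \<subseteq> V \<longleftrightarrow> S \<subseteq> V" using ij by (auto simp: swap_def)
      ultimately show ?thesis by (simp add: C')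
    qed
    have "S \<in> F \<longleftrightarrow> S \<in> shift i j F" for S
    proof -
      consider "i \<in> S" "j \<notin> S" | "j \<in> S" "i \<notin> S" | "i \<in> S \<longleftrightarrow> j \<in> S" by blast
      then show ?thesis
      proof cases
        case 1
        have "insert i (insert j (S - {i}) - {j}) = S" using 1 by auto
        then show ?thesis using 1 sw[of S] ij by (auto simp: ms swap_def)
      next
        case 2
        have "insert j (insert i (S - {j}) - {i}) = S" using 2 by auto
        then show ?thesis using 2 sw[of S] ij by (auto simp: ms swap_def)
      next
        case 3
        then show ?thesis by (auto simp: ms)
      qed
    qed
    then have "F = star V A {}" using C by blast
    then show ?thesis using A by blast
  next
    case 3
    define B where "B = A - {j}"
    have B: "finite B" "card B = r + t - 1" "i \<notin> B" "j \<notin> B" "B \<subseteq> V" "A = insert j B"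
      using finA A 3 by (auto simp: B_def)
    have cA: "card (D \<inter> A) = card (D \<inter> B)" "card (insert i D \<inter> A) = card (D \<inter> B)"
      "card (insert j D \<inter> A) = Suc (card (D \<inter> B))"
      "card (insert i (insert j D) \<inter> A) = Suc (card (D \<inter> B))"
      if "i \<notin> D" "j \<notin> D" for D
      using that B(1,3,4) ij by (simp_all add: B(6))
    have neither: "D \<in> F \<longleftrightarrow> card (D \<inter> B) \<le> 1" if "D \<subseteq> V" "i \<notin> D" "j \<notin> D" for D
      using C'[of D] cA[OF that(2,3)] that by (simp add: ms)
    have both: "insert i (insert j D) \<in> F \<longleftrightarrow> card (D \<inter> B) = 0"
      if "D \<subseteq> V" "i \<notin> D" "j \<notin> D" for D
      using C'[of "insert i (insert j D)"] cA[OF that(2,3)] that ij by (simp add: ms)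
    have fibre: "(insert i D \<in> F \<or> insert j D \<in> F \<longleftrightarrow> card (D \<inter> B) \<le> 1) \<and>
      (insert i D \<in> F \<and> insert j D \<in> F \<longleftrightarrow> card (D \<inter> B) = 0)"
      if "D \<subseteq> V" "i \<notin> D" "j \<notin> D" for D
    proof -
      have "insert i D - {i} = D" "insert j D - {j} = D" using that by auto
      then show ?thesis
        using C'[of "insert i D"] C'[of "insert j D"] cA[OF that(2,3)] that ij
        by (auto simp: ms)
    qed
    have conflict: "y = z"
      if S: "S \<subseteq> V" "i \<notin> S" "j \<notin> S" "S \<inter> B = {y}" "insert i S \<in> F"
        and T: "T \<subseteq> V" "i \<notin> T" "j \<notin> T" "T \<inter> B = {z}" "insert j T \<in> F" for S T y z
    proof (rule ccontr)
      assume yz: "y \<noteq> z"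
      have yzB: "y \<in> B" "z \<in> B" using S T by auto
      have rB: "r \<le> card B" "2 \<le> r" using B(2) r t by auto
      obtain f where f: "inj_on f {..<r}" "f ` {..<r} \<subseteq> B" "f 0 = y" "f 1 = z"
        using obtain_injection[OF B(1) rB yzB yz] by blast
      have fB: "f k \<in> B" if "k < r" for k using f(2) that by auto
      \<comment> \<open>Sets 0 and 1 cover i and j, set 2 the other points outside B; in B the union
        contains the r chosen points.\<close>
      define Fs where "Fs k = (if k = 0 then insert i S else if k = 1 then insert j T
        else if k = 2 then insert (f 2) (V - B - {i, j}) else {f k})" for k :: nat
      have Fs: "Fs k \<in> F" if k: "k < r" for k
      proof -
        have "insert (f 2) (V - B - {i, j}) \<in> F"
        proof -
          have "insert (f 2) (V - B - {i, j}) \<inter> B = {f 2}" using fB[of 2] r by auto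
          then show ?thesis using neither[of "insert (f 2) (V - B - {i, j})"] fB[of 2] r B by auto
        qed
        moreover have "{f k} \<in> F"
        proof -
          have "{f k} \<inter> B = {f k}" using fB[OF k] by auto
          then show ?thesis using neither[of "{f k}"] fB[OF k] B by auto
        qed
        ultimately show ?thesis using S T by (simp add: Fs_def)
      qed
      have "V - (\<Union>k<r. Fs k) \<subseteq> B - f ` {..<r}"
      proof
        fix u assume u: "u \<in> V - (\<Union>k<r. Fs k)"
        then have nF: "u \<notin> Fs k" if "k < r" for k using that by auto
        have "u \<noteq> i" "u \<noteq> j" using nF[of 0] nF[of 1] r by (auto simp: Fs_def)
        then have "u \<in> B" using nF[of 2] r u by (auto simp: Fs_def)
        moreover have "f k \<in> Fs k" if "k < r" for k
          using S(4) T(4) f by (auto simp: Fs_def)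
        then have "u \<notin> f ` {..<r}" using nF by auto
        ultimately show "u \<in> B - f ` {..<r}" by auto
      qed
      from card_avoid_image[OF B(1) f(1,2) this]
      have "card (V - (\<Union>k<r. Fs k)) < t" using B(2) t by simp
      moreover have "t \<le> card (V - (\<Union>k<r. Fs k))" by (rule union_boundedD[OF ub Fs])
      ultimately show False by simp
    qed
    have cases: "(\<forall>D. D \<subseteq> V \<longrightarrow> i \<notin> D \<longrightarrow> j \<notin> D \<longrightarrow> card (D \<inter> B) = 1 \<longrightarrow> insert i D \<in> F) \<or>
        (\<forall>D. D \<subseteq> V \<longrightarrow> i \<notin> D \<longrightarrow> j \<notin> D \<longrightarrow> card (D \<inter> B) = 1 \<longrightarrow> insert j D \<in> F)"
    proof (rule ccontr)
      assume "\<not> ?thesis"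
      then obtain T S where S: "S \<subseteq> V" "i \<notin> S" "j \<notin> S" "card (S \<inter> B) = 1" "insert j S \<notin> F"
        and T: "T \<subseteq> V" "i \<notin> T" "j \<notin> T" "card (T \<inter> B) = 1" "insert i T \<notin> F" by blast
      obtain y z where yz: "S \<inter> B = {y}" "T \<inter> B = {z}"
        using S(4) T(4) by (meson card_1_singletonE)
      have S': "insert i S \<in> F" and T': "insert j T \<in> F"
        using fibre[OF S(1-3)] fibre[OF T(1-3)] S T by auto
      have "y = z" by (rule conflict[OF S(1-3) yz(1) S' T(1-3) yz(2) T'])
      have "card {y} < card B" using B(2) r t by simp
      then have "\<not> B \<subseteq> {y}" using card_mono[of "{y}" B] by auto
      then obtain u where u: "u \<in> B" "u \<noteq> y" by blast
      have U: "{u} \<subseteq> V" "i \<notin> {u}" "j \<notin> {u}" "{u} \<inter> B = {u}" using u B by auto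
      then have "insert i {u} \<in> F \<or> insert j {u} \<in> F" using fibre[OF U(1-3)] by simp
      then show False
      proof
        assume "insert j {u} \<in> F"
        from conflict[OF S(1-3) yz(1) S' U this] u show False by simp
      next
        assume "insert i {u} \<in> F"
        from conflict[OF U this T(1-3) yz(2) T'] u \<open>y = z\<close> show False by simp
      qed
    qed
    have four: "S = D \<or> S = insert i D \<or> S = insert j D \<or> S = insert i (insert j D)"
      if "D = S - {i, j}" for S D using that by auto
    have tri: "c = 0 \<or> c = 1 \<or> 2 \<le> c" for c :: nat by linarith
    from cases show ?thesis
    proof
      assume all: "\<forall>D. D \<subseteq> V \<longrightarrow> i \<notin> D \<longrightarrow> j \<notin> D \<longrightarrow> card (D \<inter> B) = 1 \<longrightarrow> insert i D \<in> F"
      have D: "(insert i D \<in> F \<longleftrightarrow> card (D \<inter> B) \<le> 1) \<and> (insert j D \<in> F \<longleftrightarrow> card (D \<inter> B) = 0)"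
        if D: "D \<subseteq> V" "i \<notin> D" "j \<notin> D" for D
        using tri[of "card (D \<inter> B)"]
      proof (elim disjE)
        assume c: "card (D \<inter> B) = 1"
        show ?thesis using fibre[OF D] all[rule_format, OF D c] c by simp
      qed (use fibre[OF D] in simp_all)
      have "S \<in> F \<longleftrightarrow> S \<in> star V A {}" if SV: "S \<subseteq> V" for S
      proof -
        define E where "E = S - {i, j}"
        have E: "E \<subseteq> V" "i \<notin> E" "j \<notin> E" using SV by (auto simp: E_def)
        from four[OF E_def] show ?thesis
          using D[OF E] both[OF E] neither[OF E] cA[OF E(2,3)] E ij
          by (elim disjE) (simp_all add: star_def)
      qed
      then have "F = star V A {}" using FV unfolding star_def by blast
      then show ?thesis using A by blast
    next
      assume all: "\<forall>D. D \<subseteq> V \<longrightarrow> i \<notin> D \<longrightarrow> j \<notin> D \<longrightarrow> card (D \<inter> B) = 1 \<longrightarrow> insert j D \<in> F"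
      have D: "(insert j D \<in> F \<longleftrightarrow> card (D \<inter> B) \<le> 1) \<and> (insert i D \<in> F \<longleftrightarrow> card (D \<inter> B) = 0)"
        if D: "D \<subseteq> V" "i \<notin> D" "j \<notin> D" for D
        using tri[of "card (D \<inter> B)"]
      proof (elim disjE)
        assume c: "card (D \<inter> B) = 1"
        show ?thesis using fibre[OF D] all[rule_format, OF D c] c by simp
      qed (use fibre[OF D] in simp_all)
      define A' where "A' = insert i B"
      have cA': "card (D \<inter> A') = card (D \<inter> B)" "card (insert j D \<inter> A') = card (D \<inter> B)"
        "card (insert i D \<inter> A') = Suc (card (D \<inter> B))"
        "card (insert i (insert j D) \<inter> A') = Suc (card (D \<inter> B))"
        if "i \<notin> D" "j \<notin> D" for D
        using that B(1,3,4) ij by (simp_all add: A'_def)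
      have "S \<in> F \<longleftrightarrow> S \<in> star V A' {}" if SV: "S \<subseteq> V" for S
      proof -
        define E where "E = S - {i, j}"
        have E: "E \<subseteq> V" "i \<notin> E" "j \<notin> E" using SV by (auto simp: E_def)
        from four[OF E_def] show ?thesis
          using D[OF E] both[OF E] neither[OF E] cA'[OF E(2,3)] E ij
          by (elim disjE) (simp_all add: star_def)
      qed
      then have "F = star V A' {}" using FV unfolding star_def by blast
      moreover have "A' \<subseteq> V" "card A' = r + t" using B ij r by (auto simp: A'_def)
      ultimately show ?thesis by blast
    qed
  qed
qed

section \<open>Reduction to shifted families\<close>

text \<open>An entry \<open>False\<close> marks membership, so that downsets become families
  closed under raising entries to \<open>True\<close>.\<close>

definition marked :: "'a list \<Rightarrow> bool list \<Rightarrow> 'a set" where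
  "marked xs v = {x. (x, False) \<in> set (zip xs v)}"

lemma marked_Cons: "marked (x # xs) (b # v) = (if b then {} else {x}) \<union> marked xs v"
  by (auto simp: marked_def)

lemma marked_append:
  "length xs = length v \<Longrightarrow> marked (xs @ ys) (v @ w) = marked xs v \<union> marked ys w"
  by (auto simp: marked_def)

lemma marked_subset: "marked xs v \<subseteq> set xs"
  by (auto simp: marked_def dest: set_zip_leftD)

lemma marked_map: "marked xs (map (\<lambda>x. x \<notin> S) xs) = S \<inter> set xs"
proof (induction xs)
  case Nil
  then show ?case by (simp add: marked_def)
qed (auto simp: marked_Cons)

lemma map_marked:
  "distinct xs \<Longrightarrow> length v = length xs \<Longrightarrow> map (\<lambda>x. x \<notin> marked xs v) xs = v"
proof (induction xs arbitrary: v)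
  case (Cons x xs)
  then obtain b w where v: "v = b # w" by (cases v) auto
  have "x \<notin> marked xs w" using Cons.prems marked_subset[of xs w] by auto
  then have head: "(x \<notin> marked (x # xs) v) = b" by (simp add: v marked_Cons)
  have "map (\<lambda>y. y \<notin> marked (x # xs) v) xs = map (\<lambda>y. y \<notin> marked xs w) xs"
    using Cons.prems by (auto simp: v marked_Cons)
  also have "\<dots> = w" using Cons.prems by (intro Cons.IH) (auto simp: v)
  finally have tail: "map (\<lambda>y. y \<notin> marked (x # xs) v) xs = w" .
  show ?case using head tail by (simp add: v)
qed simp

lemma marked_replicate [simp]: "marked xs (replicate n True) = {}"
  by (auto simp: marked_def dest: set_zip_rightD)

text \<open>A lower bound suffices: the star will be found inside a family of this size.\<close>

lemma card_star:
  assumes "finite V" "A \<subseteq> V"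
  shows "(card A + 1) * 2 ^ (card V - card A) \<le> card (star V A {})"
proof -
  let ?C = "insert {} ((\<lambda>a. {a}) ` A)"
  have fin: "finite A" using assms finite_subset by blast
  have "inj_on (\<lambda>(C, S). C \<union> S) (?C \<times> Pow (V - A))"
  proof (rule inj_onI, clarify)
    fix C S D T assume *: "C \<in> ?C" "D \<in> ?C" "S \<subseteq> V - A" "T \<subseteq> V - A" "C \<union> S = D \<union> T"
    have "C \<subseteq> A" "D \<subseteq> A" using *(1,2) by auto
    then have "(C \<union> S) \<inter> A = C" "(D \<union> T) \<inter> A = D" "(C \<union> S) - A = S" "(D \<union> T) - A = T"
      using *(3,4) by blast+
    then show "C = D \<and> S = T" unfolding *(5) by (simp only:)
  qed
  then have "card (?C \<times> Pow (V - A)) = card ((\<lambda>(C, S). C \<union> S) ` (?C \<times> Pow (V - A)))"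
    by (simp only: card_image)
  also have "\<dots> \<le> card (star V A {})"
  proof (rule card_mono)
    show "finite (star V A {})"
      by (rule finite_subset[of _ "Pow V"]) (use assms(1) in \<open>auto simp: star_def\<close>)
    show "(\<lambda>(C, S). C \<union> S) ` (?C \<times> Pow (V - A)) \<subseteq> star V A {}"
    proof clarify
      fix C S assume *: "C \<in> ?C" "S \<subseteq> V - A"
      then have "(C \<union> S) \<inter> A = C" by auto
      then show "C \<union> S \<in> star V A {}" using * assms(2) by (auto simp: star_def)
    qed
  qed
  also have "card (?C \<times> Pow (V - A)) = (card A + 1) * 2 ^ (card V - card A)"
  proof -
    have "card ?C = card A + 1" using fin by (subst card_insert_disjoint) (auto simp: card_image)
    then show ?thesis
      using assms fin by (simp add: card_cartesian_product card_Pow card_Diff_subset)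
  qed
  finally show ?thesis .
qed

lemma obtain_split:
  assumes "length xs = k + Suc m"
  obtains ys x zs where "xs = ys @ x # zs" "length ys = k" "length zs = m"
proof
  show "xs = take k xs @ xs ! k # drop (Suc k) xs"
    using assms by (intro id_take_nth_drop) simp
qed (use assms in auto)

lemma shifted_family_bound:
  fixes V :: "nat set"
  assumes r: "3 \<le> r" and t: "1 \<le> t" "t < 2 ^ r - r - 1"
    and V: "finite V" "F \<subseteq> Pow V" and down: "downset F" and ub: "union_bounded r t V F"
    and single: "\<And>x. x \<in> V \<Longrightarrow> {x} \<in> F"
    and closed: "\<And>a b. a \<in> V \<Longrightarrow> b \<in> V \<Longrightarrow> b < a \<Longrightarrow> shift b a F = F"
  shows "card F * 2 ^ (r + t) \<le> (r + t + 1) * 2 ^ card V \<and>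
    (card F * 2 ^ (r + t) = (r + t + 1) * 2 ^ card V \<longrightarrow>
      (\<exists>A\<subseteq>V. card A = r + t \<and> F = star V A {}))"
proof (cases "V = {}")
  case True
  have "F = {}"
  proof (rule ccontr)
    assume "F \<noteq> {}"
    then obtain S where "S \<in> F" by blast
    then have "t \<le> card (V - (\<Union>i<r. S))" by (intro union_boundedD[OF ub])
    then show False using t True by simp
  qed
  then show ?thesis by simp
next
  case False
  \<comment> \<open>In decreasing order, replacing an element by a smaller one moves a letter
    \<open>False\<close> to the right, which is upwards in the prefix order.\<close>
  define xs where "xs = rev (sorted_list_of_set V)"
  define n where "n = length xs"
  have xs: "set xs = V" "distinct xs" "n = card V"
    using V by (simp_all add: xs_def n_def)
  have dec: "sorted_wrt (>) xs"
    using strict_sorted_list_of_set[of V] by (simp add: xs_def sorted_wrt_rev)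
  define L where "L = {v. length v = n \<and> marked xs v \<in> F}"
  have len: "\<forall>v\<in>L. length v = n" by (simp add: L_def)
  have enc: "map (\<lambda>x. x \<notin> S) xs \<in> L \<longleftrightarrow> S \<in> F" if "S \<subseteq> V" for S
    using that xs by (auto simp: L_def n_def marked_map Int_absorb2)
  have "bij_betw (marked xs) L F"
    using V(2) xs(1,2)
    by (intro bij_betw_byWitness[where f' = "\<lambda>S. map (\<lambda>x. x \<notin> S) xs"])
      (auto simp: L_def n_def map_marked marked_map Int_absorb2 subset_iff)
  then have dens: "dens n L = card F / 2 ^ n"
    by (simp add: dens_def bij_betw_same_card)
  have d: "T \<in> F" if "S \<in> F" "T \<subseteq> S" for S T using down that by (auto simp: downset_def)
  have sh: "shifted n L"
  proof (rule shiftedI[OF len])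
    fix u w assume L: "u @ False # w \<in> L"
    then have l: "length xs = length u + Suc (length w)" by (simp add: L_def n_def)
    then obtain xa a xb where x: "xs = xa @ a # xb" "length xa = length u"
      by (rule obtain_split)
    then have "marked xs (u @ True # w) \<subseteq> marked xs (u @ False # w)"
      by (auto simp: marked_append marked_Cons)
    moreover have "marked xs (u @ False # w) \<in> F" using L by (simp add: L_def)
    ultimately have "marked xs (u @ True # w) \<in> F" by (rule d[rotated])
    then show "u @ True # w \<in> L" using L by (simp add: L_def)
  next
    fix u w z assume L: "u @ False # w @ True # z \<in> L"
    then have l: "length xs = length u + Suc (length w + Suc (length z))"
      by (simp add: L_def n_def)
    then obtain xa a ys where x: "xs = xa @ a # ys" "length xa = length u"
      and "length ys = length w + Suc (length z)" by (rule obtain_split)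
    then obtain xb b xc where y: "ys = xb @ b # xc" "length xb = length w"
      using obtain_split[of ys] by metis
    define S where "S = marked xs (u @ False # w @ True # z)"
    have S: "S = marked xa u \<union> insert a (marked xb w \<union> marked xc z)"
      using x y by (simp add: S_def marked_append marked_Cons)
    have ab: "b < a" "a \<in> V" "b \<in> V" "a \<in> S" "b \<notin> S"
      using dec xs(1,2) marked_subset[of xa u] marked_subset[of xb w] marked_subset[of xc z]
      by (auto simp: x y S sorted_wrt_append)
    have "S \<in> shift b a F" using L ab by (simp add: S_def L_def closed)
    then have "insert b (S - {a}) \<in> F" using ab by (simp add: mem_shift)
    moreover have "marked xs (u @ True # w @ False # z) \<subseteq> insert b (S - {a})"
      using xs(2) marked_subset[of xa u] marked_subset[of xb w] marked_subset[of xc z]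
      by (auto simp: x y S marked_append marked_Cons)
    ultimately have "marked xs (u @ True # w @ False # z) \<in> F" by (rule d)
    then show "u @ True # w @ False # z \<in> L" using L by (simp add: L_def)
  qed
  have hits: "hits r t L"
  proof (rule hits_of_intersecting[OF sh t(1)])
    fix vs assume vs: "\<And>j. j < r \<Longrightarrow> vs j \<in> L"
    have "t \<le> card (V - (\<Union>j<r. marked xs (vs j)))"
      using vs by (intro union_boundedD[OF ub]) (auto simp: L_def)
    also have "\<dots> \<le> card ((!) xs ` {k. k < n \<and> (\<forall>j<r. vs j ! k)})"
    proof (intro card_mono subsetI)
      fix x assume x: "x \<in> V - (\<Union>j<r. marked xs (vs j))"
      then obtain k where k: "k < n" "x = xs ! k"
        using xs(1) by (auto simp: n_def in_set_conv_nth)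
      have "vs j ! k" if j: "j < r" for j
      proof (rule ccontr)
        assume "\<not> vs j ! k"
        moreover have "length (vs j) = n" using vs[OF j] by (simp add: L_def)
        ultimately have "(x, False) \<in> set (zip xs (vs j))"
          using k by (auto simp: set_zip n_def intro!: exI[of _ k])
        then show False using x j by (auto simp: marked_def)
      qed
      then show "x \<in> (!) xs ` {k. k < n \<and> (\<forall>j<r. vs j ! k)}" using k by auto
    qed simp
    also have "\<dots> \<le> card {k. k < n \<and> (\<forall>j<r. vs j ! k)}" by (rule card_image_le) simp
    finally show "t \<le> card {k. k < n \<and> (\<forall>j<r. vs j ! k)}" .
  qed (use r in simp)
  obtain y ys where ys: "xs = y # ys" using False xs(1) by (cases xs) auto
  have nt: "False # replicate (n - 1) True \<in> L"
    using single[of y] xs(1) by (auto simp: L_def n_def ys marked_Cons)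
  note bound = ext_boundD[OF ext_bound[OF r] t sh hits nt]
  have "real (card F) * 2 ^ (r + t) \<le> real (r + t + 1) * 2 ^ n"
    using bound(1) unfolding dens by (simp add: field_simps del: of_nat_add of_nat_Suc)
  then have "real (card F * 2 ^ (r + t)) \<le> real ((r + t + 1) * 2 ^ n)"
    by (simp only: of_nat_mult of_nat_power of_nat_numeral)
  then have le: "card F * 2 ^ (r + t) \<le> (r + t + 1) * 2 ^ n" by (simp only: of_nat_le_iff)
  have "\<exists>A\<subseteq>V. card A = r + t \<and> F = star V A {}"
    if eq: "card F * 2 ^ (r + t) = (r + t + 1) * 2 ^ n"
  proof -
    have "real (card F * 2 ^ (r + t)) = real ((r + t + 1) * 2 ^ n)" by (simp only: eq)
    then have "real (card F) * 2 ^ (r + t) = real (r + t + 1) * 2 ^ n"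
      by (simp only: of_nat_mult of_nat_power of_nat_numeral)
    then have "dens n L = real (r + t + 1) / 2 ^ (r + t)"
      unfolding dens by (simp add: field_simps del: of_nat_add of_nat_Suc)
    from bound(2)[OF this]
    have v0: "False # replicate (r + t - 1) True @ replicate (n - r - t) False \<in> L" .
    then have rtn: "r + t \<le> n" using t by (auto simp: L_def)
    \<comment> \<open>These are the r + t positions where words dominating the extremal word have at
      most one \<open>False\<close>.\<close>
    define A where "A = set (take (r + t) xs)"
    have A: "A \<subseteq> V" "card A = r + t"
      using xs(1,2) rtn by (auto simp: A_def n_def distinct_card dest: in_set_takeD)
    have sub: "star V A {} \<subseteq> F"
    proof
      fix S assume "S \<in> star V A {}"
      then have S: "S \<subseteq> V" "card (S \<inter> A) \<le> 1" by (auto simp: star_def)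
      define v where "v = map (\<lambda>x. x \<notin> S) xs"
      have low: "i - 1 \<le> cnt v i" if i: "i \<le> r + t" for i
      proof -
        have "xs ! k \<in> A" if "k < i" for k
          using nth_mem[of k "take (r + t) xs"] i rtn that by (simp add: A_def n_def)
        then have "(!) xs ` {k. k < i \<and> xs ! k \<in> S} \<subseteq> S \<inter> A" by auto
        then have "card ((!) xs ` {k. k < i \<and> xs ! k \<in> S}) \<le> card (S \<inter> A)"
          by (intro card_mono) (auto simp: A_def)
        moreover have "inj_on ((!) xs) {k. k < i \<and> xs ! k \<in> S}"
          using i rtn xs(2) by (auto simp: inj_on_def n_def nth_eq_iff_index_eq)
        ultimately have "card {k. k < i \<and> xs ! k \<in> S} \<le> 1" using S(2) by (simp add: card_image)
        moreover have "{k. k < i \<and> k < length v \<and> v ! k} = {..<i} - {k. k < i \<and> xs ! k \<in> S}"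
          using i rtn by (auto simp: v_def n_def)
        then have "cnt v i = i - card {k. k < i \<and> xs ! k \<in> S}"
          by (simp only: cnt_card) (subst card_Diff_subset, auto)
        ultimately show ?thesis by simp
      qed
      have "dominated (False # replicate (r + t - 1) True @ replicate (n - r - t) False) v"
        unfolding dominated_def
      proof (intro conjI allI)
        show "length (False # replicate (r + t - 1) True @ replicate (n - r - t) False) = length v"
          using rtn t by (simp add: v_def n_def)
        fix i
        show "cnt (False # replicate (r + t - 1) True @ replicate (n - r - t) False) i \<le> cnt v i"
        proof (cases i)
          case (Suc k)
          have "min k (r + t - 1) \<le> cnt v i"
          proof (cases "i \<le> r + t")
            case True
            then show ?thesis using low[of i] Suc by simp
          next
            case False
            then have "cnt v (r + t) \<le> cnt v i" by (intro cnt_mono) simp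
            then show ?thesis using low[of "r + t"] by simp
          qed
          then show ?thesis by (simp add: Suc cnt_append)
        qed simp
      qed
      then have "v \<in> L" by (rule shiftedD[OF sh v0])
      then show "S \<in> F" using enc[OF S(1)] by (simp add: v_def)
    qed
    have "(r + t + 1) * 2 ^ (n - (r + t)) \<le> card (star V A {})"
      using card_star[OF V(1) A(1)] by (simp add: A(2) xs(3))
    then have "(r + t + 1) * 2 ^ (n - (r + t)) * 2 ^ (r + t) \<le> card (star V A {}) * 2 ^ (r + t)"
      by (rule mult_right_mono) simp
    moreover have "(r + t + 1) * 2 ^ (n - (r + t)) * 2 ^ (r + t) = (r + t + 1) * 2 ^ n"
      using rtn by (simp only: mult.assoc power_add[symmetric]) simp
    ultimately have "card F * 2 ^ (r + t) \<le> card (star V A {}) * 2 ^ (r + t)" by (simp only: eq)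
    then have "card F \<le> card (star V A {})" by simp
    moreover have "finite F" using V finite_subset by auto
    ultimately have "star V A {} = F" using sub by (intro card_seteq)
    then show ?thesis using A by blast
  qed
  with le show ?thesis unfolding xs(3) by blast
qed

text \<open>Shifting towards smaller elements lowers the sum of all elements of all sets, so it ends
  in a family closed under such shifts. All singletons remain, and with them non-triviality.\<close>

lemma downset_bound:
  fixes V :: "nat set"
  assumes r: "3 \<le> r" and t: "1 \<le> t" "t < 2 ^ r - r - 1" and "finite V"
    and "F \<subseteq> Pow V" "downset F" "union_bounded r t V F" "\<And>x. x \<in> V \<Longrightarrow> {x} \<in> F"
  shows "card F * 2 ^ (r + t) \<le> (r + t + 1) * 2 ^ card V \<and>
    (card F * 2 ^ (r + t) = (r + t + 1) * 2 ^ card V \<longrightarrow>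
      (\<exists>A\<subseteq>V. card A = r + t \<and> F = star V A {}))"
  using assms(5-)
proof (induction "\<Sum>S\<in>F. \<Sum>S" arbitrary: F rule: less_induct)
  case less
  show ?case
  proof (cases "\<forall>a\<in>V. \<forall>b\<in>V. b < a \<longrightarrow> shift b a F = F")
    case True
    then show ?thesis using less.prems by (intro shifted_family_bound r t \<open>finite V\<close>) auto
  next
    case False
    then obtain a b where ab: "a \<in> V" "b \<in> V" "b < a" "shift b a F \<noteq> F" by blast
    then have ne: "b \<noteq> a" by simp
    have fin: "finite S" if "S \<in> F" for S
      using that less.prems(1) \<open>finite V\<close> finite_subset by blast
    have "finite F" using less.prems(1) \<open>finite V\<close> finite_subset by auto
    have smaller: "(\<Sum>S\<in>shift b a F. \<Sum>S) < (\<Sum>S\<in>F. \<Sum>S)"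
      unfolding shift_def
    proof (rule sum_push_less)
      show "push (swap b a) (\<lambda>S. b \<in> S \<and> a \<notin> S) F \<noteq> F" using ab(4) by (simp add: shift_def)
      fix S assume S: "S \<in> F" "b \<in> swap b a S \<and> a \<notin> swap b a S"
      then have S': "a \<in> S" "b \<notin> S" using ne by (auto simp: swap_def split: if_splits)
      then have "\<Sum>(swap b a S) = b + \<Sum>(S - {a})" "\<Sum>S = a + \<Sum>(S - {a})"
        using fin[OF S(1)] by (auto simp: swap_def sum.remove)
      then show "\<Sum>(swap b a S) < \<Sum>S" using ab(3) by simp
    qed (use ne \<open>finite F\<close> in \<open>auto simp: swap_def\<close>)
    have sub: "shift b a F \<subseteq> Pow V"
    proof
      fix S assume "S \<in> shift b a F"
      then have "S \<in> F \<or> insert a (S - {b}) \<in> F" by (auto simp: mem_shift[OF ne] split: if_splits)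
      then show "S \<in> Pow V" using less.prems(1) ab(1,2) by auto
    qed
    have IH: "card (shift b a F) * 2 ^ (r + t) \<le> (r + t + 1) * 2 ^ card V \<and>
      (card (shift b a F) * 2 ^ (r + t) = (r + t + 1) * 2 ^ card V \<longrightarrow>
        (\<exists>A\<subseteq>V. card A = r + t \<and> shift b a F = star V A {}))"
    proof (rule less.hyps[OF smaller sub])
      show "downset (shift b a F)" by (rule downset_shift[OF ne less.prems(2)])
      show "union_bounded r t V (shift b a F)"
        by (rule union_bounded_shift[OF ne ab(2,1) \<open>finite V\<close> less.prems(3)])
      show "{x} \<in> shift b a F" if "x \<in> V" for x
        using less.prems(4)[OF that] less.prems(4)[OF ab(2)] ne by (auto simp: mem_shift)
    qed
    then show ?thesis
      unfolding card_shift[OF ne]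
      using shift_back[OF r t(1) \<open>finite V\<close> less.prems(1,3) _ _ ne ab(2,1)] by blast
  qed
qed

section \<open>Arbitrary agreeing families\<close>

definition spans :: "'a set \<Rightarrow> 'a set set \<Rightarrow> bool" where
  "spans V F \<longleftrightarrow> (\<forall>x\<in>V. (\<exists>S\<in>F. x \<in> S) \<and> (\<exists>S\<in>F. x \<notin> S))"

text \<open>A set and its complement agree nowhere, so G contains at most one of them.\<close>

lemma agreeing_pairs_bound:
  assumes "finite W" "G \<subseteq> Pow W" "agreeing 2 1 W G"
  shows "2 * card G \<le> 2 ^ card W"
proof -
  have fin: "finite G" using assms finite_subset by auto
  have disj: "G \<inter> (\<lambda>S. W - S) ` G = {}"
  proof (rule ccontr)
    assume "\<not> ?thesis"
    then obtain S where S: "S \<in> G" "W - S \<in> G" by auto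
    have "1 \<le> card {x \<in> W. agree_on 2 (\<lambda>i. if i = 0 then S else W - S) x}"
      using S by (intro agreeingD[OF assms(3)]) auto
    moreover have "{x \<in> W. agree_on 2 (\<lambda>i. if i = 0 then S else W - S) x} = {}"
      by (auto simp: agree_on_def numeral_2_eq_2 All_less_Suc)
    ultimately show False by simp
  qed
  have "inj_on (\<lambda>S. W - S) G" using assms(2) by (intro inj_onI) blast
  then have "2 * card G = card (G \<union> (\<lambda>S. W - S) ` G)"
    using fin disj by (simp add: card_Un_disjoint card_image)
  also have "\<dots> \<le> card (Pow W)" using assms by (intro card_mono) auto
  finally show ?thesis using assms(1) by (simp add: card_Pow)
qed

text \<open>r and t vary in the outer induction because a family losing non-triviality at x is
  compared on V - {x} with parameters (r, t - 1) or, for t = 1, with (r - 1, 1). Each comparison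
  yields r + t in place of r + t + 1; the inequality is strict and equality cannot arise
  there.\<close>

theorem agreeing_bound:
  fixes V :: "nat set"
  assumes "3 \<le> r" "1 \<le> t" "t < 2 ^ r - r - 1" "finite V" "F \<subseteq> Pow V" "agreeing r t V F" "spans V F"
  shows "card F * 2 ^ (r + t) \<le> (r + t + 1) * 2 ^ card V \<and>
    (card F * 2 ^ (r + t) = (r + t + 1) * 2 ^ card V \<longrightarrow>
      (\<exists>A R. A \<subseteq> V \<and> card A = r + t \<and> R \<subseteq> A \<and> F = star V A R))"
  using assms
proof (induction "card V" arbitrary: r t V F rule: less_induct)
  case outer: less
  note r = outer.prems(1) and t = outer.prems(2,3) and finV = outer.prems(4)
  show ?case
    using outer.prems(5-)
  proof (induction "\<Sum>S\<in>F. card S" arbitrary: F rule: less_induct)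
    case less
    have finF: "finite F" using less.prems(1) finV finite_subset by auto
    have fin: "finite S" if "S \<in> F" for S
      using that less.prems(1) finV finite_subset by blast
    consider "\<forall>x\<in>V. compress x F = F"
      | x where "x \<in> V" "compress x F \<noteq> F" "spans V (compress x F)"
      | x where "x \<in> V" "\<not> spans V (compress x F)" by blast
    then show ?case
    proof cases
      case 1
      then have down: "downset F" using downset_of_compress[OF finV less.prems(1)] by blast
      have "card F * 2 ^ (r + t) \<le> (r + t + 1) * 2 ^ card V \<and>
        (card F * 2 ^ (r + t) = (r + t + 1) * 2 ^ card V \<longrightarrow>
          (\<exists>A\<subseteq>V. card A = r + t \<and> F = star V A {}))"
      proof (rule downset_bound[OF r t finV less.prems(1) down])
        show "union_bounded r t V F"
          using union_bounded_of_agreeing[OF _ finV down less.prems(2)] r by simp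
        show "{x} \<in> F" if "x \<in> V" for x
          using less.prems(3) down that unfolding spans_def downset_def by blast
      qed
      then show ?thesis by blast
    next
      case 2
      have smaller: "(\<Sum>S\<in>compress x F. card S) < (\<Sum>S\<in>F. card S)"
        unfolding compress_def
      proof (rule sum_push_less)
        show "push (\<lambda>S. if x \<in> S then S - {x} else insert x S) (\<lambda>S. x \<notin> S) F \<noteq> F"
          using 2(2) by (simp add: compress_def)
        fix S assume S: "S \<in> F" "x \<notin> (if x \<in> S then S - {x} else insert x S)"
        then have "x \<in> S" by (auto split: if_splits)
        then show "card (if x \<in> S then S - {x} else insert x S) < card S"
          using card_Diff1_less[OF fin[OF S(1)]] by simp
      qed (use finF in \<open>auto simp: insert_absorb\<close>)
      have sub: "compress x F \<subseteq> Pow V"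
      proof
        fix S assume "S \<in> compress x F"
        then have "S \<in> F \<or> insert x S \<in> F" by (auto simp: mem_compress split: if_splits)
        then show "S \<in> Pow V" using less.prems(1) by auto
      qed
      have "card (compress x F) * 2 ^ (r + t) \<le> (r + t + 1) * 2 ^ card V \<and>
        (card (compress x F) * 2 ^ (r + t) = (r + t + 1) * 2 ^ card V \<longrightarrow>
          (\<exists>A R. A \<subseteq> V \<and> card A = r + t \<and> R \<subseteq> A \<and> compress x F = star V A R))"
        by (rule less.hyps[OF smaller sub agreeing_compress[OF finV less.prems(2)] 2(3)])
      moreover have "\<exists>A R. A \<subseteq> V \<and> card A = r + t \<and> R \<subseteq> A \<and> F = star V A R"
        if "\<exists>A R. A \<subseteq> V \<and> card A = r + t \<and> R \<subseteq> A \<and> compress x F = star V A R"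
      proof -
        from that obtain A R where A: "A \<subseteq> V" "card A = r + t" "R \<subseteq> A" "compress x F = star V A R"
          by blast
        from compress_back[OF r t(1) finV less.prems(1,2) A]
        obtain Q where "Q \<subseteq> A" "F = star V A Q" by blast
        with A(1,2) show ?thesis by blast
      qed
      ultimately show ?thesis unfolding card_compress by simp
    next
      case 3
      define W where "W = V - {x}"
      define G where "G = (\<lambda>S. S - {x}) ` F"
      have W: "finite W" "card W < card V" "card V = Suc (card W)"
        using finV 3(1) card_Suc_Diff1[OF finV 3(1)] by (auto simp: W_def)
      have GW: "G \<subseteq> Pow W" using less.prems(1) by (auto simp: G_def W_def)
      have mem: "S - {x} \<in> compress x F" if "S \<in> F" for S
        using that by (cases "x \<in> S") (simp_all add: mem_compress insert_absorb)
      \<comment> \<open>Deleting x keeps the witnesses at all other points and supplies sets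
        avoiding x. Non-triviality can fail only because no compressed set contains x, that is, no S
        and S - {x} are both in F.\<close>
      have no: "T \<notin> compress x F" if "x \<in> T" for T
      proof
        assume T: "T \<in> compress x F"
        have "spans V (compress x F)"
          unfolding spans_def
        proof
          fix y assume y: "y \<in> V"
          obtain S S' where S: "S \<in> F" "y \<in> S" "S' \<in> F" "y \<notin> S'"
            using less.prems(3) y unfolding spans_def by blast
          have "\<exists>S\<in>compress x F. y \<notin> S"
            by (rule bexI[OF _ mem[OF S(3)]]) (use S(4) in simp)
          moreover have "\<exists>S\<in>compress x F. y \<in> S"
          proof (cases "y = x")
            case True
            then show ?thesis using T that by blast
          next
            case False
            then show ?thesis by (intro bexI[OF _ mem[OF S(1)]]) (use S(2) in simp)
          qed
          ultimately show "(\<exists>S\<in>compress x F. y \<in> S) \<and> (\<exists>S\<in>compress x F. y \<notin> S)" by simp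
        qed
        then show False using 3(2) by simp
      qed
      have "inj_on (\<lambda>S. S - {x}) F"
      proof (rule inj_onI, rule ccontr)
        fix S T assume ST: "S \<in> F" "T \<in> F" "S - {x} = T - {x}" "S \<noteq> T"
        then have "x \<in> S \<and> T = S - {x} \<or> x \<in> T \<and> S = T - {x}" by blast
        then show False
        proof (elim disjE conjE)
          assume "x \<in> S" "T = S - {x}"
          then show False using no[of S] ST(1,2) by (simp add: mem_compress)
        next
          assume "x \<in> T" "S = T - {x}"
          then show False using no[of T] ST(1,2) by (simp add: mem_compress)
        qed
      qed
      then have cardG: "card G = card F" by (simp add: G_def card_image)
      have spG: "spans W G"
        unfolding spans_def
      proof
        fix y assume y: "y \<in> W"
        then have "y \<in> V" "y \<noteq> x" by (auto simp: W_def)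
        then obtain S S' where S: "S \<in> F" "y \<in> S" "S' \<in> F" "y \<notin> S'"
          using less.prems(3) unfolding spans_def by blast
        then show "(\<exists>S\<in>G. y \<in> S) \<and> (\<exists>S\<in>G. y \<notin> S)"
          using \<open>y \<noteq> x\<close> by (auto simp: G_def)
      qed
      have pos: "0 < (2::nat) ^ card V" by simp
      have expand: "(r + t + 1) * 2 ^ card V = (r + t) * 2 ^ card V + 2 ^ card V"
        by (simp add: algebra_simps)
      have "card F * 2 ^ (r + t) < (r + t + 1) * 2 ^ card V"
      proof (cases "t = 1")
        case False
        have "agreeing r (t - 1) W G"
          unfolding agreeing_def
        proof (intro allI impI)
          fix Gs assume "\<forall>i<r. Gs i \<in> G"
          then have "\<exists>S. S \<in> F \<and> Gs i = S - {x}" if "i < r" for i using that by (auto simp: G_def)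
          then obtain Fs where Fs: "\<And>i. i < r \<Longrightarrow> Fs i \<in> F" "\<And>i. i < r \<Longrightarrow> Gs i = Fs i - {x}"
            by metis
          have "{y \<in> V. agree_on r Fs y} - {x} \<subseteq> {y \<in> W. agree_on r Gs y}"
            using Fs(2) by (auto simp: W_def agree_on_def)
          then have "card ({y \<in> V. agree_on r Fs y} - {x}) \<le> card {y \<in> W. agree_on r Gs y}"
            using W(1) by (intro card_mono) auto
          moreover have "t \<le> card {y \<in> V. agree_on r Fs y}" by (rule agreeingD[OF less.prems(2) Fs(1)])
          moreover have "card {y \<in> V. agree_on r Fs y} - 1 \<le> card ({y \<in> V. agree_on r Fs y} - {x})"
            by (cases "x \<in> {y \<in> V. agree_on r Fs y}") (use finV in auto)
          ultimately show "t - 1 \<le> card {y \<in> W. agree_on r Gs y}" by linarith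
        qed
        then have "card G * 2 ^ (r + (t - 1)) \<le> (r + (t - 1) + 1) * 2 ^ card W"
          using outer.hyps[OF W(2) r _ _ W(1) GW _ spG, of "t - 1"] t False by simp
        then have "2 * (card F * 2 ^ (r + (t - 1))) \<le> 2 * ((r + t) * 2 ^ card W)"
          using False t by (simp add: cardG)
        moreover have "2 * (card F * 2 ^ (r + (t - 1))) = card F * 2 ^ (r + t)"
          using t(1) by (cases t) auto
        moreover have "2 * ((r + t) * 2 ^ card W) = (r + t) * 2 ^ card V" by (simp add: W(3))
        ultimately have "card F * 2 ^ (r + t) \<le> (r + t) * 2 ^ card V" by linarith
        then show ?thesis using pos expand by linarith
      next
        case t1: True
        have ag: "agreeing (r - 1) 1 W G"
          unfolding agreeing_def
        proof (intro allI impI)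
          fix Gs assume "\<forall>i<r-1. Gs i \<in> G"
          then have "\<exists>S. S \<in> F \<and> Gs i = S - {x}" if "i < r - 1" for i using that by (auto simp: G_def)
          then obtain Fs where Fs: "\<And>i. i < r - 1 \<Longrightarrow> Fs i \<in> F" "\<And>i. i < r - 1 \<Longrightarrow> Gs i = Fs i - {x}"
            by metis
          obtain S S' where S: "S \<in> F" "x \<in> S" "S' \<in> F" "x \<notin> S'"
            using less.prems(3) 3(1) unfolding spans_def by blast
          \<comment> \<open>A last set that differs from the first at x excludes x as an agreement,
            so the r sets agree at another point.\<close>
          define Hs where "Hs = Fs(r - 1 := if x \<in> Fs 0 then S' else S)"
          have "1 \<le> card {y \<in> V. agree_on r Hs y}"
            using agreeingD[OF less.prems(2), of Hs] Fs(1) S t1 by (auto simp: Hs_def)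
          then have "{y \<in> V. agree_on r Hs y} \<noteq> {}" by (metis card.empty not_one_le_zero)
          then obtain y where y: "y \<in> V" "agree_on r Hs y" by blast
          have "\<not> agree_on r Hs x"
          proof
            assume "agree_on r Hs x"
            then have "x \<in> Hs 0 \<longleftrightarrow> x \<in> Hs (r - 1)" using r by (auto simp: agree_on_def)
            then show False using S r by (auto simp: Hs_def split: if_splits)
          qed
          then have "y \<noteq> x" using y(2) by auto
          moreover have "agree_on (r - 1) Hs y" using y(2) by (auto simp: agree_on_def)
          then have "agree_on (r - 1) Gs y"
            using \<open>y \<noteq> x\<close> agree_on_cong[of "r - 1" y Hs Gs] Fs(2) by (simp add: Hs_def)
          ultimately have "y \<in> {y \<in> W. agree_on (r - 1) Gs y}" using y(1) by (simp add: W_def)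
          then have "card {y \<in> W. agree_on (r - 1) Gs y} \<noteq> 0" using W(1) by (auto simp: card_eq_0_iff)
          then show "1 \<le> card {y \<in> W. agree_on (r - 1) Gs y}" by simp
        qed
        show ?thesis
        proof (cases "r = 3")
          case True
          with ag have "2 * card G \<le> 2 ^ card W" using agreeing_pairs_bound[OF W(1) GW] by simp
          then have "card F * 16 \<le> 4 * 2 ^ card V" by (simp add: cardG W(3))
          then have "card F * 16 < 5 * 2 ^ card V" using pos by linarith
          then show ?thesis using True t1 by simp
        next
          case False
          then have r4: "3 \<le> r - 1" using r by simp
          have "1 < 2 ^ (r - 1) - (r - 1) - 1" using two_r_less[OF r4] r4 by linarith
          then have "card G * 2 ^ (r - 1 + 1) \<le> (r - 1 + 1 + 1) * 2 ^ card W"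
            using outer.hyps[OF W(2) r4 _ _ W(1) GW ag spG] by simp
          then have "2 * (card F * 2 ^ r) \<le> 2 * ((r + 1) * 2 ^ card W)"
            using r by (simp add: cardG)
          then have "card F * 2 ^ (r + t) \<le> (r + t) * 2 ^ card V" using t1 by (simp add: W(3))
          then show ?thesis using pos expand by linarith
        qed
      qed
      then show ?thesis by simp
    qed
  qed
qed

theorem theorem3:
  fixes n r t :: nat and \<F> :: "nat set set"
  assumes "n > r" and "r \<ge> 3" and "1 \<le> t" and "t < 2^r - r - 1"
    and "\<F> \<subseteq> Pow {1..n}"
    and "nontrivial n \<F>"
    and "r_wise_t_agreeing n r t \<F>"
    and "card \<F> = (r + t + 1) * 2^(n - r - t)"
  shows "\<exists>A R. A \<subseteq> {1..n} \<and> card A = r + t \<and> R \<subseteq> A \<and>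
           \<F> = {(F - R) \<union> (R - F) | F. F \<subseteq> {1..n} \<and> card (F \<inter> A) \<le> 1}"
proof -
  have "spans {1..n} \<F>"
    unfolding spans_def
  proof
    fix x assume "x \<in> {1..n}"
    then have "x \<in> \<Union>\<F>" "x \<notin> \<Inter>\<F>" using assms(6) by (auto simp: nontrivial_def)
    then show "(\<exists>S\<in>\<F>. x \<in> S) \<and> (\<exists>S\<in>\<F>. x \<notin> S)" by blast
  qed
  moreover have "agreeing r t {1..n} \<F>"
    using assms(7) by (simp add: agreeing_def r_wise_t_agreeing_def)
  ultimately have bound: "card \<F> * 2 ^ (r + t) \<le> (r + t + 1) * 2 ^ n"
    and ext: "card \<F> * 2 ^ (r + t) = (r + t + 1) * 2 ^ n \<Longrightarrow>
      \<exists>A R. A \<subseteq> {1..n} \<and> card A = r + t \<and> R \<subseteq> A \<and> \<F> = star {1..n} A R"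
    using agreeing_bound[of r t "{1..n}" \<F>] assms(2-5) by auto
  \<comment> \<open>Subtraction truncates: for n < r + t the assumed size would be r + t + 1, more
    than the bound allows.\<close>
  have "r + t \<le> n"
  proof (rule ccontr)
    assume "\<not> r + t \<le> n"
    then have "n - r - t = 0" "n < r + t" by auto
    then have "(r + t + 1) * 2 ^ (r + t) \<le> (r + t + 1) * 2 ^ n" using bound assms(8) by simp
    then have "(2::nat) ^ (r + t) \<le> 2 ^ n" by (simp only: mult_le_cancel1)
    then show False using \<open>n < r + t\<close> by simp
  qed
  then have "n - r - t + (r + t) = n" by simp
  then have "card \<F> * 2 ^ (r + t) = (r + t + 1) * 2 ^ n"
    unfolding assms(8) by (simp only: mult.assoc power_add[symmetric])
  then obtain A R where A: "A \<subseteq> {1..n}" "card A = r + t" "R \<subseteq> A" "\<F> = star {1..n} A R"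
    using ext by blast
  then have RV: "R \<subseteq> {1..n}" by blast
  have "\<F> = {(F - R) \<union> (R - F) | F. F \<subseteq> {1..n} \<and> card (F \<inter> A) \<le> 1}"
  proof (intro set_eqI iffI)
    fix S assume "S \<in> \<F>"
    then have S: "S \<subseteq> {1..n}" "card (symdiff S R \<inter> A) \<le> 1" by (auto simp: A(4) star_def)
    have "S = (symdiff S R - R) \<union> (R - symdiff S R)" by auto
    moreover have "symdiff S R \<subseteq> {1..n}" using S(1) symdiff_subset_iff[OF RV] by blast
    ultimately show "S \<in> {(F - R) \<union> (R - F) | F. F \<subseteq> {1..n} \<and> card (F \<inter> A) \<le> 1}"
      using S(2) by blast
  next
    fix S assume "S \<in> {(F - R) \<union> (R - F) | F. F \<subseteq> {1..n} \<and> card (F \<inter> A) \<le> 1}"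
    then obtain F where F: "S = symdiff F R" "F \<subseteq> {1..n}" "card (F \<inter> A) \<le> 1"
      by (auto simp: symdiff_def)
    moreover have "S \<subseteq> {1..n}" using F(1,2) symdiff_subset_iff[OF RV] by blast
    ultimately show "S \<in> \<F>" by (simp add: A(4) star_def)
  qed
  with A(1-3) show ?thesis by blast
qed

end
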